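(* Let $X$ be a discrete random variable with $H(X)<\infty$ and let $n\in\mathbb{N}$. There exist i.i.d. discrete random variables $Z_1,\ldots,Z_n$ and a function $f$ such that $X\stackrel{d}{=}f(Z_1,\ldots,Z_n)$ and $$H(Z_1)-r_{\mathrm{ID}}(F_{\iota_X})\frac{H(X)}{n}\le\min\left\{2.43,\;H_{\mathrm b}\left(\min\left\{\sqrt{\frac{e}{(e-1)\log e}\cdot\frac{H(X)}{n}},\,\frac12\right\}\right)+H_{\mathrm b}(2^{-1/n})+2(1-2^{-1/n})\right\}.$$
   Context: $\mathbb{N}=\{1,2,\ldots\}$. All logarithms $\log$ are to base $2$; $H$ is Shannon entropy in bits; $H_{\mathrm b}(x):=-x\log x-(1-x)\log(1-x)$. $X\stackrel{d}{=}Y$ means equality in distribution. For a discrete random variable $X$ with pmf $p_X$, the self information is $\iota_X(x):=-\log p_X(x)$ and the information spectrum cdf is $F_{\iota_X}(t):=\mathbf{P}(\iota_X(X)\le t)$; its mean equals $H(X)$. $\mathcal{P}_+$ denotes the set of cdf's of probability distributions on $[0,\infty)$. For $F\in\mathcal{P}_+$, $E(F):=\int_0^\infty t\,dF(t)$. For cdf's, $F_1\le F_2$ means $F_1(t)\le F_2(t)$ for all $t$. $F_1*F_2$ is the cdf of the sum of independent random variables with cdf's $F_1,F_2$, and $F^{*n}$ is the $n$-fold convolution of $F$ with itself. $\mathcal{P}_+^{*n}:=\{F^{*n}:F\in\mathcal{P}_+\}$ and $\mathcal{P}_+^{*\infty}:=\bigcap_{n\in\mathbb{N}}\mathcal{P}_+^{*n}$.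 For $F\in\mathcal{P}_+$ with finite mean, $r_{\mathrm{ID}}(F):=\frac{1}{E(F)}\inf\{E(\tilde F):\tilde F\in\mathcal{P}_+^{*\infty},\ \tilde F\le F\}$ if $E(F)>0$, and $r_{\mathrm{ID}}(F):=1$ if $E(F)=0$. *)

theory Defs
  imports "HOL-Probability.Probability"
begin

text \<open>
  A discrete random variable is given by its law, a \<^typ>\<open>'a pmf\<close>.
  Entropies and expectations of nonnegative quantities take values in \<^typ>\<open>ennreal\<close>, so that
  infinite values are represented faithfully.
\<close>

definition self_info :: "'a pmf \<Rightarrow> 'a \<Rightarrow> real" where
  "self_info p x = - log 2 (pmf p x)"

definition info_spectrum_cdf :: "'a pmf \<Rightarrow> real \<Rightarrow> real" where
  "info_spectrum_cdf p t = measure_pmf.prob p {x. self_info p x \<le> t}"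

text \<open>Points of mass zero contribute nothing, as \<^term>\<open>0 * log 2 0 = (0::real)\<close>.\<close>

definition shannon_entropy :: "'a pmf \<Rightarrow> ennreal" where
  "shannon_entropy p = (\<integral>\<^sup>+x. ennreal (- pmf p x * log 2 (pmf p x)) \<partial>count_space UNIV)"

definition binary_entropy :: "real \<Rightarrow> real" where
  "binary_entropy x = - x * log 2 x - (1 - x) * log 2 (1 - x)"

definition nonneg_cdfs :: "(real \<Rightarrow> real) set" where
  "nonneg_cdfs = {cdf M | M. real_distribution M \<and> measure M {0..} = 1}"

text \<open>
  For a cdf \<open>F\<close>, \<^term>\<open>interval_measure F\<close> is the probability distribution with cdf \<open>F\<close>.
\<close>

definition cdf_mean :: "(real \<Rightarrow> real) \<Rightarrow> ennreal" where
  "cdf_mean F = (\<integral>\<^sup>+t\<in>{0..}. ennreal t \<partial>interval_measure F)"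

definition cdf_conv :: "(real \<Rightarrow> real) \<Rightarrow> (real \<Rightarrow> real) \<Rightarrow> real \<Rightarrow> real" where
  "cdf_conv F G = cdf (interval_measure F \<star> interval_measure G)"

text \<open>The zeroth convolution power is the unit of convolution, the cdf of the point mass at 0.\<close>

primrec cdf_conv_power :: "(real \<Rightarrow> real) \<Rightarrow> nat \<Rightarrow> real \<Rightarrow> real" where
  "cdf_conv_power F 0 = cdf (return borel 0)"
| "cdf_conv_power F (Suc n) = cdf_conv F (cdf_conv_power F n)"

definition divisible_cdfs :: "nat \<Rightarrow> (real \<Rightarrow> real) set" where
  "divisible_cdfs n = {cdf_conv_power F n | F. F \<in> nonneg_cdfs}"

definition inf_divisible_cdfs :: "(real \<Rightarrow> real) set" where
  "inf_divisible_cdfs = (\<Inter>n\<in>{1..}. divisible_cdfs n)"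

text \<open>Only meaningful for \<^term>\<open>F \<in> nonneg_cdfs\<close> with finite mean.\<close>

definition r_ID :: "(real \<Rightarrow> real) \<Rightarrow> ennreal" where
  "r_ID F = (if cdf_mean F = 0 then 1
     else (INF G \<in> {G \<in> inf_divisible_cdfs. G \<le> F}. cdf_mean G) / cdf_mean F)"

end

theory Submission
  imports Defs
begin

text \<open>
  For \<open>n = 1\<close> take \<open>X\<close> itself.  For \<open>n \<ge> 2\<close>, suppose that the \<open>n\<close>-fold convolution
  of a law \<open>M\<close> on \<open>[0, \<infinity>)\<close> dominates the information spectrum of \<open>X\<close>.  Choose a discrete \<open>W\<close> whose self-information dominates \<open>M\<close> and whose entropy
  exceeds the mean of \<open>M\<close> by at most a binary entropy.  The self-information of \<open>n\<close> independent copies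
  of \<open>W\<close> then dominates that of \<open>X\<close>.  Laying out the atoms of both in decreasing order on \<open>[0, 1)\<close>,
  every atom of the copies of \<open>W\<close> meets at most two atoms of \<open>X\<close>, so that \<open>X\<close> is a function of the
  copies of \<open>W\<close> and of an independent source able to simulate every coin; such a source is
  distributed over the \<open>n\<close> copies at entropy less than
  \<open>H\<^sub>b(2\<^sup>-\<^sup>1\<^sup>/\<^sup>n) + 2 (1 - 2\<^sup>-\<^sup>1\<^sup>/\<^sup>n)\<close> per copy.

  The law \<open>M\<close> comes either from an infinitely divisible cdf that nearly attains the infimum, or, when
  the infimum is too large, directly from the \<open>n\<close>-th root of the information spectrum cdf; in both
  cases its mean is at most \<open>e/(e - 1)\<close> times \<open>H(X)/n\<close>.
\<close>

section \<open>Laws on the nonnegative reals and their convolutions\<close>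

text \<open>Convolution and integration are available for measures, so the proof works with laws;
  \<open>interval_measure_cdf\<close> and \<open>cdf_conv_power_cdf\<close> carry the results back
  to cdfs.\<close>

definition nonneg_law :: "real measure \<Rightarrow> bool" where
  "nonneg_law M \<longleftrightarrow> real_distribution M \<and> (AE x in M. 0 \<le> x)"

definition law_mean :: "real measure \<Rightarrow> ennreal" where
  "law_mean M = (\<integral>\<^sup>+x. ennreal x \<partial>M)"

primrec conv_power :: "real measure \<Rightarrow> nat \<Rightarrow> real measure" where
  "conv_power M 0 = return borel 0"
| "conv_power M (Suc n) = (M \<star> conv_power M n)"

lemma nonneg_lawD: "nonneg_law M \<Longrightarrow> real_distribution M"
  by (simp add: nonneg_law_def)

lemma nonneg_cdfs_eq: "nonneg_cdfs = cdf ` {M. nonneg_law M}"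
proof -
  have "measure M {0..} = 1 \<longleftrightarrow> (AE x in M. 0 \<le> x)" if "real_distribution M" for M
  proof -
    interpret real_distribution M by fact
    show ?thesis
      using AE_in_set_eq_1[of "{0..}"] by simp
  qed
  then show ?thesis
    unfolding nonneg_cdfs_def nonneg_law_def by auto
qed

lemma interval_measure_cdf:
  assumes "real_distribution M"
  shows "interval_measure (cdf M) = M"
proof -
  interpret real_distribution M by fact
  show ?thesis
  proof (rule cdf_unique)
    show "real_distribution (interval_measure (cdf M))"
      by (intro real_distribution_interval_measure cdf_nondecreasing cdf_is_right_cont
          cdf_lim_at_bot cdf_lim_at_top_prob)
    show "cdf (interval_measure (cdf M)) = cdf M"
      by (intro cdf_interval_measure cdf_nondecreasing cdf_is_right_cont cdf_lim_at_bot)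
  qed fact
qed

lemma real_distribution_convolution:
  assumes "real_distribution M" "real_distribution N"
  shows "real_distribution (M \<star> N)"
proof -
  interpret M: real_distribution M by fact
  interpret N: real_distribution N by fact
  interpret pair_prob_space M N ..
  show ?thesis
    unfolding convolution_def by (rule real_distribution_distr) simp
qed

lemma cdf_conv_cdf:
  assumes "real_distribution M" "real_distribution N"
  shows "cdf_conv (cdf M) (cdf N) = cdf (M \<star> N)"
  using assms by (simp add: cdf_conv_def interval_measure_cdf)

lemma real_distribution_return: "real_distribution (return borel (c::real))"
  by (simp add: real_distribution_def real_distribution_axioms_def prob_space_return)

lemma real_distribution_conv_power:
  "real_distribution M \<Longrightarrow> real_distribution (conv_power M n)"
  by (induction n) (auto intro: real_distribution_convolution real_distribution_return)

lemma cdf_conv_power_cdf: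
  "real_distribution M \<Longrightarrow> cdf_conv_power (cdf M) n = cdf (conv_power M n)"
  by (induction n) (auto simp: cdf_conv_cdf real_distribution_conv_power)

lemma nonneg_law_convolution:
  assumes "nonneg_law M" "nonneg_law N"
  shows "nonneg_law (M \<star> N)"
proof -
  interpret M: real_distribution M using assms by (simp add: nonneg_lawD)
  interpret N: real_distribution N using assms by (simp add: nonneg_lawD)
  interpret pair_prob_space M N ..
  have "AE x in M. AE y in N. 0 \<le> x + y"
    using assms(1)[unfolded nonneg_law_def, THEN conjunct2]
  proof eventually_elim
    case (elim x)
    show ?case
      using assms(2)[unfolded nonneg_law_def, THEN conjunct2]
      by eventually_elim (use elim in simp)
  qed
  then have "AE z in M \<Otimes>\<^sub>M N. 0 \<le> fst z + snd z"
    by (intro AE_pair_measure borel_measurable_le) simp_all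
  then have "AE z in M \<star> N. 0 \<le> z"
    unfolding convolution_def by (subst AE_distr_iff) (auto simp: case_prod_beta)
  then show ?thesis
    by (simp add: nonneg_law_def real_distribution_convolution M.real_distribution_axioms
        N.real_distribution_axioms)
qed

lemma nonneg_law_return: "0 \<le> c \<Longrightarrow> nonneg_law (return borel c)"
  by (simp add: nonneg_law_def real_distribution_return AE_return)

lemma nonneg_law_conv_power: "nonneg_law M \<Longrightarrow> nonneg_law (conv_power M n)"
  by (induction n) (auto intro: nonneg_law_convolution nonneg_law_return)

lemma law_mean_convolution:
  assumes "nonneg_law M" "nonneg_law N"
  shows "law_mean (M \<star> N) = law_mean M + law_mean N"
proof -
  interpret M: real_distribution M using assms by (simp add: nonneg_lawD)
  interpret N: real_distribution N using assms by (simp add: nonneg_lawD)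
  have "law_mean (M \<star> N) = (\<integral>\<^sup>+x. \<integral>\<^sup>+y. ennreal (x + y) \<partial>N \<partial>M)"
    unfolding law_mean_def
    by (rule nn_integral_convolution) (auto simp: M.finite_measure_axioms N.finite_measure_axioms)
  also have "\<dots> = (\<integral>\<^sup>+x. \<integral>\<^sup>+y. ennreal x + ennreal y \<partial>N \<partial>M)"
    using assms(1)[unfolded nonneg_law_def, THEN conjunct2]
  proof (intro nn_integral_cong_AE, eventually_elim)
    case (elim x)
    show ?case
      using assms(2)[unfolded nonneg_law_def, THEN conjunct2]
      by (intro nn_integral_cong_AE, eventually_elim) (use elim in simp)
  qed
  also have "\<dots> = law_mean M + law_mean N"
    by (simp add: nn_integral_add law_mean_def M.emeasure_space_1[simplified] N.emeasure_space_1[simplified])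
  finally show ?thesis .
qed

lemma law_mean_conv_power:
  "nonneg_law M \<Longrightarrow> law_mean (conv_power M n) = of_nat n * law_mean M"
proof (induction n)
  case 0
  show ?case by (simp add: law_mean_def nn_integral_return)
next
  case (Suc n)
  then show ?case
    by (simp add: law_mean_convolution nonneg_law_conv_power algebra_simps)
qed

text \<open>Negative \<open>t\<close> count as 0 on both sides, once through the restricted domain
  of integration and once through the truncation by \<open>ennreal\<close>.\<close>

lemma cdf_mean_cdf:
  assumes "real_distribution M"
  shows "cdf_mean (cdf M) = law_mean M"
  unfolding cdf_mean_def law_mean_def interval_measure_cdf[OF assms]
  by (intro nn_integral_cong) (auto simp: indicator_def ennreal_neg)

section \<open>Monotonicity of convolutions and means in the cdf order\<close>

lemma cdf_convolution:
  assumes "real_distribution M" "real_distribution N"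
  shows "ennreal (cdf (M \<star> N) t) = (\<integral>\<^sup>+x. ennreal (cdf N (t - x)) \<partial>M)"
proof -
  interpret M: real_distribution M by fact
  interpret N: real_distribution N by fact
  interpret MN: real_distribution "M \<star> N" using assms by (rule real_distribution_convolution)
  have "ennreal (cdf (M \<star> N) t) = (\<integral>\<^sup>+x. emeasure N {a. a + x \<in> {..t}} \<partial>M)"
    unfolding cdf_def MN.emeasure_eq_measure[symmetric]
    by (rule convolution_emeasure) (auto simp: M.finite_measure_axioms N.finite_measure_axioms)
  also have "\<dots> = (\<integral>\<^sup>+x. emeasure N {..t - x} \<partial>M)"
    by (intro nn_integral_cong arg_cong[where f = "emeasure N"]) auto
  finally show ?thesis
    by (simp add: cdf_def N.emeasure_eq_measure)
qed

text \<open>Conditioning on the first summand gives monotonicity in the second; commutativity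
  transfers it to the first.\<close>

lemma cdf_convolution_mono:
  assumes "real_distribution M" "real_distribution N" "real_distribution M'" "real_distribution N'"
    and "cdf M \<le> cdf M'" "cdf N \<le> cdf N'"
  shows "cdf (M \<star> N) \<le> cdf (M' \<star> N')"
proof -
  have right: "cdf (M \<star> N) \<le> cdf (M \<star> N')"
    if "real_distribution M" "real_distribution N" "real_distribution N'" "cdf N \<le> cdf N'" for M N N'
  proof (rule le_funI)
    fix t
    have "ennreal (cdf (M \<star> N) t) \<le> ennreal (cdf (M \<star> N') t)"
      using that by (simp add: cdf_convolution le_fun_def ennreal_leI nn_integral_mono)
    then show "cdf (M \<star> N) t \<le> cdf (M \<star> N') t"
      by (simp add: cdf_def)
  qed
  have comm: "(M \<star> N) = (N \<star> M)" if "real_distribution M" "real_distribution N" for M N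
    using that
    by (intro convolution_commutative) (auto simp: real_distribution_def real_distribution_axioms_def
        prob_space.finite_measure)
  have "cdf (M \<star> N) \<le> cdf (M \<star> N')"
    using assms by (intro right)
  also have "(M \<star> N') = (N' \<star> M)"
    using assms by (intro comm)
  also have "cdf (N' \<star> M) \<le> cdf (N' \<star> M')"
    using assms by (intro right)
  also have "(N' \<star> M') = (M' \<star> N')"
    using assms by (intro comm)
  finally show ?thesis .
qed

lemma cdf_conv_power_mono:
  assumes "real_distribution M" "real_distribution N" "cdf M \<le> cdf N"
  shows "cdf (conv_power M n) \<le> cdf (conv_power N n)"
proof (induction n)
  case (Suc n)
  then show ?case
    unfolding conv_power.simps using assms
    by (intro cdf_convolution_mono real_distribution_conv_power)
qed simp

text \<open>Tonelli applied to the region \<open>0 \<le> t < x\<close>. With the mean written as the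
  area above the cdf, pointwise comparison of cdfs compares means.\<close>

lemma law_mean_layer_cake:
  assumes "real_distribution M"
  shows "law_mean M = (\<integral>\<^sup>+t\<in>{0..}. ennreal (1 - cdf M t) \<partial>lborel)"
proof -
  interpret real_distribution M by fact
  interpret pair_sigma_finite M lborel ..
  have "law_mean M = (\<integral>\<^sup>+x. (\<integral>\<^sup>+t. indicator {(x, t). 0 \<le> t \<and> t < x} (x, t) \<partial>lborel) \<partial>M)"
    unfolding law_mean_def
  proof (rule nn_integral_cong)
    fix x :: real
    have "(\<integral>\<^sup>+t. indicator {(x, t). 0 \<le> t \<and> t < x} (x, t) \<partial>lborel)
        = (\<integral>\<^sup>+t. indicator {0..<x} t \<partial>lborel)"
      by (intro nn_integral_cong) (auto simp: indicator_def)
    also have "\<dots> = ennreal x"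
      by (cases "0 \<le> x") (auto simp: ennreal_neg)
    finally show "ennreal x = (\<integral>\<^sup>+t. indicator {(x, t). 0 \<le> t \<and> t < x} (x, t) \<partial>lborel)" ..
  qed
  also have "\<dots> = (\<integral>\<^sup>+t. (\<integral>\<^sup>+x. indicator {(x, t). 0 \<le> t \<and> t < x} (x, t) \<partial>M) \<partial>lborel)"
    by (rule Fubini'[symmetric]) measurable
  also have "\<dots> = (\<integral>\<^sup>+t\<in>{0..}. ennreal (1 - cdf M t) \<partial>lborel)"
  proof (rule nn_integral_cong)
    fix t :: real
    have "(\<integral>\<^sup>+x. indicator {(x, t). 0 \<le> t \<and> t < x} (x, t) \<partial>M)
        = (\<integral>\<^sup>+x. indicator {0..} t * indicator {t<..} x \<partial>M)"
      by (intro nn_integral_cong) (auto simp: indicator_def)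
    also have "\<dots> = indicator {0..} t * emeasure M {t<..}"
      by (simp add: nn_integral_cmult_indicator)
    also have "{t<..} = space M - {..t}"
      by auto
    also have "emeasure M (space M - {..t}) = ennreal (1 - cdf M t)"
      unfolding emeasure_eq_measure by (subst prob_compl) (auto simp: cdf_def)
    finally show "(\<integral>\<^sup>+x. indicator {(x, t). 0 \<le> t \<and> t < x} (x, t) \<partial>M)
        = ennreal (1 - cdf M t) * indicator {0..} t"
      by (simp add: mult.commute)
  qed
  finally show ?thesis .
qed

lemma law_mean_antimono:
  assumes "real_distribution M" "real_distribution N" "cdf M \<le> cdf N"
  shows "law_mean N \<le> law_mean M"
  unfolding law_mean_layer_cake[OF assms(1)] law_mean_layer_cake[OF assms(2)]
  using assms(3) by (intro nn_integral_mono mult_right_mono ennreal_leI) (auto simp: le_fun_def)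

lemma neg_mult_log_nonneg:
  fixes x :: real
  assumes "0 \<le> x" "x \<le> 1"
  shows "0 \<le> - x * log 2 x"
  using assms by (cases "x = 0") (auto simp: mult_nonneg_nonpos)

section \<open>A dominated convolution root with a bounded mean\<close>

text \<open>The right-hand side is minus the chord of the concave \<open>ln\<close> between
  \<open>exp (- 1)\<close> and \<open>1\<close>; this chord is where the factor
  \<open>e/(e - 1)\<close> comes from.\<close>

lemma neg_ln_le_linear:
  fixes x :: real
  assumes "exp (- 1) \<le> x" "x \<le> 1"
  shows "- ln x \<le> exp 1 / (exp 1 - 1) * (1 - x)"
proof -
  define l where "l = exp 1 / (exp 1 - 1) * (1 - x)"
  have e1: "exp (1::real) > 1"
    by simp
  have x: "x = (1 - l) * 1 + l * exp (- 1)"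
    using e1 by (simp add: l_def exp_minus divide_simps) (simp add: algebra_simps)
  have l: "0 \<le> l" "l \<le> 1"
    using assms e1 by (auto simp: l_def exp_minus field_simps)
  have "- l = (1 - l) * ln 1 + l * ln (exp (- 1))"
    by simp
  also have "\<dots> \<le> ln ((1 - l) * 1 + l * exp (- 1))"
    using concave_onD[OF ln_concave l, of 1 "exp (- 1)"] by simp
  also have "\<dots> = ln x"
    using x by simp
  finally show ?thesis
    by (simp add: l_def)
qed

text \<open>
  If \<open>F\<close> is the cdf of \<open>M\<close>, then the maximum of \<open>n\<close> independent variables with cdf \<open>F\<close> to the
  power \<open>1/n\<close> has cdf \<open>F\<close>, and their sum is larger.  Applying this to the part of \<open>M\<close> above the
  \<open>1/e\<close>-quantile \<open>a\<close>, and shifting by \<open>a/n\<close>, loses at most a factor \<open>e/(e - 1)\<close> in the mean.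
\<close>

lemma exists_root_law:
  assumes M: "nonneg_law M" and n: "n \<ge> 1"
  obtains N where "nonneg_law N" "cdf (conv_power N n) \<le> cdf M"
    "of_nat n * law_mean N \<le> ennreal (exp 1 / (exp 1 - 1)) * law_mean M"
proof -
  interpret M: real_distribution M using M by (rule nonneg_lawD)
  define c :: real where "c = exp 1 / (exp 1 - 1)"
  have e1: "exp (1::real) > 1"
    by simp
  have c0: "c \<ge> 0"
    by (simp add: c_def)
  define F where "F = cdf M"
  have F_mono: "F x \<le> F y" if "x \<le> y" for x y
    using that by (simp add: F_def M.cdf_nondecreasing)
  have F_bounds: "0 \<le> F x" "F x \<le> 1" for x
    by (simp_all add: F_def M.cdf_nonneg M.cdf_bounded_prob)
  define S where "S = {t. 0 \<le> t \<and> exp (- 1) \<le> F t}"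
  define a where "a = Inf S"
  have "\<forall>\<^sub>F t in at_top. exp (- 1) < F t \<and> 0 \<le> t"
    unfolding F_def using M.cdf_lim_at_top_prob
    by (intro eventually_conj order_tendstoD(1) eventually_ge_at_top) auto
  then have S_ne: "S \<noteq> {}"
    by (auto simp: S_def eventually_at_top_linorder intro: less_imp_le)
  have S_bdd: "bdd_below S"
    by (rule bdd_belowI[of _ 0]) (simp add: S_def)
  have a0: "0 \<le> a"
    unfolding a_def using S_ne by (rule cInf_greatest) (simp add: S_def)
  have below_a: "F t < exp (- 1)" if "0 \<le> t" "t < a" for t
    using that cInf_lower[OF _ S_bdd, of t] by (force simp: S_def a_def)
  have Fa: "exp (- 1) \<le> F a"
  proof (rule tendsto_lowerbound)
    show "(F \<longlongrightarrow> F a) (at_right a)"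
      using M.cdf_is_right_cont[of a] by (simp add: F_def continuous_within)
    show "\<forall>\<^sub>F t in at_right a. exp (- 1) \<le> F t"
      unfolding eventually_at_right_field
    proof (intro exI[of _ "a + 1"] conjI allI impI)
      fix t assume "a < t" "t < a + 1"
      then obtain s where "s \<in> S" "s < t"
        unfolding a_def using S_ne S_bdd cInf_less_iff by blast
      then show "exp (- 1) \<le> F t"
        using F_mono[of s t] by (simp add: S_def)
    qed simp
  qed simp
  define b where "b = a / n"
  have b0: "0 \<le> b"
    using a0 by (simp add: b_def)
  \<comment> \<open>All mass below \<open>a\<close> is moved to \<open>a\<close> before shifting by
    \<open>b - a\<close>. The cdf of \<open>M'\<close> is therefore 0 below \<open>b\<close> and at
    least \<open>exp (- 1)\<close> from \<open>b\<close> on, the range of the chord bound.\<close>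
  define M' where "M' = distr M borel (\<lambda>x. max x a - a + b)"
  interpret M': real_distribution M'
    unfolding M'_def by (rule M.real_distribution_distr) simp
  have cdf_M': "cdf M' t = (if t < b then 0 else F (t - b + a))" for t
  proof -
    have "cdf M' t = M.prob {x. max x a \<le> t - b + a}"
      unfolding M'_def cdf_def by (subst measure_distr) (auto intro!: arg_cong[where f = M.prob])
    also have "{x. max x a \<le> t - b + a} = (if t < b then {} else {..t - b + a})"
      by auto
    finally show ?thesis
      by (auto simp: F_def cdf_def)
  qed
  define G where "G y = root n (F (a + y))" for y
  define N where "N = interval_measure (\<lambda>t. root n (cdf M' t))"
  have n0: "n > 0"
    using n by simp
  have root_mono: "root n (cdf M' x) \<le> root n (cdf M' y)" if "x \<le> y" for x y
    using M'.cdf_nondecreasing[OF that] n0 by simp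
  have root_lims: "continuous (at_right x) (\<lambda>t. root n (cdf M' t))"
      "((\<lambda>t. root n (cdf M' t)) \<longlongrightarrow> 0) at_bot" "((\<lambda>t. root n (cdf M' t)) \<longlongrightarrow> 1) at_top" for x
    using M'.cdf_is_right_cont[of x] tendsto_real_root[OF M'.cdf_lim_at_bot, of n]
      tendsto_real_root[OF M'.cdf_lim_at_top_prob, of n] n0
    by (auto intro!: continuous_real_root)
  interpret N: real_distribution N
    unfolding N_def using root_mono root_lims by (intro real_distribution_interval_measure)
  have cdf_N: "cdf N t = (if t < b then 0 else G (t - b))" for t
    unfolding N_def G_def using root_mono root_lims
    by (subst cdf_interval_measure) (auto simp: cdf_M' algebra_simps n0)
  have "AE x in N. b \<le> x"
  proof -
    have "(cdf N \<longlongrightarrow> measure N {..<b}) (at_left b)"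
      by (rule N.cdf_at_left)
    moreover have "(cdf N \<longlongrightarrow> 0) (at_left b)"
      by (rule Lim_transform_eventually[OF tendsto_const])
        (auto simp: eventually_at_left_field cdf_N intro!: exI[of _ "b - 1"])
    ultimately have "measure N {..<b} = 0"
      by (intro tendsto_unique) auto
    then show ?thesis
      by (subst (asm) N.prob_eq_0) (auto simp: not_less)
  qed
  then have N: "nonneg_law N"
    unfolding nonneg_law_def using b0 by (auto simp: N.real_distribution_axioms elim!: AE_mp)

  have G_mono: "G x \<le> G y" if "x \<le> y" for x y
    using that n0 by (simp add: G_def F_mono)
  have G0: "0 \<le> G y" for y
    using n0 by (simp add: G_def F_bounds)
  \<comment> \<open>If \<open>k\<close> independent variables, all at least \<open>b\<close>, have a
    sum at most \<open>t\<close>, then each is at most \<open>t - (k - 1) * b\<close>, where the cdf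
    of \<open>N\<close> is \<open>G (t - k * b)\<close>. For \<open>k = n\<close> the bound becomes
    \<open>F t\<close>, since \<open>n * b = a\<close>.\<close>
  have conv: "cdf (conv_power N k) t \<le> (if t < k * b then 0 else G (t - k * b) ^ k)" for k t
  proof (induction k arbitrary: t)
    case 0
    show ?case by (simp add: cdf_def measure_return)
  next
    case (Suc k)
    have "ennreal (cdf (conv_power N (Suc k)) t)
        = (\<integral>\<^sup>+x. ennreal (cdf (conv_power N k) (t - x)) \<partial>N)"
      by (simp add: cdf_convolution N.real_distribution_axioms real_distribution_conv_power)
    also have "\<dots> \<le> (\<integral>\<^sup>+x. (if t < Suc k * b then 0 else ennreal (G (t - Suc k * b) ^ k))
        * indicator {..t - k * b} x \<partial>N)"
    proof (intro nn_integral_mono_AE)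
      show "AE x in N. ennreal (cdf (conv_power N k) (t - x))
          \<le> (if t < Suc k * b then 0 else ennreal (G (t - Suc k * b) ^ k)) * indicator {..t - k * b} x"
        using \<open>AE x in N. b \<le> x\<close>
      proof eventually_elim
        case (elim x)
        show ?case
        proof (cases "t - x < k * b")
          case True
          then show ?thesis using Suc.IH[of "t - x"] by (simp add: ennreal_neg)
        next
          case False
          have "cdf (conv_power N k) (t - x) \<le> G (t - x - k * b) ^ k"
            using Suc.IH[of "t - x"] False by simp
          also have "\<dots> \<le> G (t - Suc k * b) ^ k"
            using elim by (intro power_mono G_mono G0) (simp add: algebra_simps)
          finally show ?thesis
            using False elim by (auto intro!: ennreal_leI simp: algebra_simps)
        qed
      qed
    qed
    also have "\<dots> = (if t < Suc k * b then 0 else ennreal (G (t - Suc k * b) ^ k))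
        * ennreal (cdf N (t - k * b))"
      by (simp add: nn_integral_cmult_indicator cdf_def N.emeasure_eq_measure)
    also have "\<dots> = ennreal (if t < Suc k * b then 0 else G (t - Suc k * b) ^ Suc k)"
      by (auto simp: cdf_N algebra_simps G0 ennreal_mult[symmetric])
    finally show ?case
      by (subst (asm) ennreal_le_iff) (auto simp: G0)
  qed
  have "cdf (conv_power N n) \<le> cdf M"
  proof (rule le_funI)
    fix t
    have nb: "n * b = a"
      using n0 by (simp add: b_def)
    show "cdf (conv_power N n) t \<le> cdf M t"
      using conv[of n t] n0 F_bounds[of t] unfolding nb F_def[symmetric]
      by (auto simp: G_def split: if_splits)
  qed

  \<comment> \<open>From \<open>b\<close> on, \<open>n * (1 - G) \<le> - n * ln G = - ln F\<close>,
    and the chord bound applies. Below \<open>b\<close> the tail of \<open>N\<close> is 1 and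
    contributes \<open>n * b = a\<close> in all; this is paid for by
    \<open>c * (1 - F) \<ge> 1\<close> on \<open>{0..<a}\<close>, where
    \<open>F < exp (- 1)\<close>.\<close>
  moreover have "of_nat n * law_mean N \<le> ennreal c * law_mean M"
  proof -
    have [measurable]: "F \<in> borel_measurable borel" "cdf N \<in> borel_measurable borel"
      by (auto intro!: borel_measurable_mono monoI simp: F_mono N.cdf_nondecreasing)
    have "of_nat n * law_mean N = (\<integral>\<^sup>+t\<in>{0..}. ennreal (n * (1 - cdf N t)) \<partial>lborel)"
      unfolding law_mean_layer_cake[OF N.real_distribution_axioms]
      by (subst nn_integral_cmult[symmetric])
        (auto simp: ennreal_mult N.cdf_bounded_prob mult.assoc ennreal_of_nat_eq_real_of_nat)
    also have "\<dots> \<le> (\<integral>\<^sup>+t. ennreal n * indicator {0..<b} t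
        + ennreal (c * (1 - F (t - b + a))) * indicator {b..} t \<partial>lborel)"
    proof (rule nn_integral_mono)
      fix t :: real
      have "n * (1 - cdf N t) \<le> c * (1 - F (t - b + a))" if "b \<le> t"
      proof -
        have Ft: "exp (- 1) \<le> F (a + (t - b))"
          using Fa F_mono[of a "a + (t - b)"] that by simp
        then have Fpos: "0 < F (a + (t - b))"
          using exp_gt_zero[of "- 1 :: real"] by linarith
        then have Gpos: "0 < G (t - b)"
          using n0 by (simp add: G_def)
        have "n * (1 - G (t - b)) \<le> n * (- ln (G (t - b)))"
          using ln_le_minus_one[OF Gpos] by (intro mult_left_mono) auto
        also have "\<dots> = - ln (G (t - b) ^ n)"
          using Gpos by (simp add: ln_realpow)
        also have "\<dots> = - ln (F (a + (t - b)))"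
          using n0 Fpos by (simp add: G_def)
        also have "\<dots> \<le> c * (1 - F (a + (t - b)))"
          unfolding c_def using Ft F_bounds(2) by (rule neg_ln_le_linear)
        finally show ?thesis
          using that by (simp add: cdf_N algebra_simps)
      qed
      then show "ennreal (n * (1 - cdf N t)) * indicator {0..} t \<le> ennreal n * indicator {0..<b} t
          + ennreal (c * (1 - F (t - b + a))) * indicator {b..} t"
        using b0 by (auto simp: indicator_def cdf_N intro!: ennreal_leI)
    qed
    also have "\<dots> = ennreal n * ennreal b
        + (\<integral>\<^sup>+t. ennreal (c * (1 - F (t - b + a))) * indicator {b..} t \<partial>lborel)"
      using b0 by (subst nn_integral_add) (auto simp: nn_integral_cmult_indicator)
    also have "(\<integral>\<^sup>+t. ennreal (c * (1 - F (t - b + a))) * indicator {b..} t \<partial>lborel)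
        = (\<integral>\<^sup>+t. ennreal (c * (1 - F t)) * indicator {a..} t \<partial>lborel)"
      by (subst nn_integral_real_affine[of "\<lambda>t. ennreal (c * (1 - F t)) * indicator {a..} t" 1 "a - b"])
        (auto intro!: nn_integral_cong simp: indicator_def algebra_simps)
    also have "ennreal n * ennreal b = (\<integral>\<^sup>+t. indicator {0..<a} t \<partial>lborel)"
      using a0 b0 n0 by (simp add: ennreal_mult[symmetric] b_def)
    also have "\<dots> + (\<integral>\<^sup>+t. ennreal (c * (1 - F t)) * indicator {a..} t \<partial>lborel)
        = (\<integral>\<^sup>+t. indicator {0..<a} t + ennreal (c * (1 - F t)) * indicator {a..} t \<partial>lborel)"
      by (subst nn_integral_add) auto
    also have "\<dots> \<le> (\<integral>\<^sup>+t\<in>{0..}. ennreal (c * (1 - F t)) \<partial>lborel)"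
    proof (rule nn_integral_mono)
      fix t :: real
      have "1 \<le> c * (1 - F t)" if "0 \<le> t" "t < a"
      proof -
        have "1 = c * (1 - exp (- 1))"
          using e1 by (simp add: c_def exp_minus field_simps)
        also have "\<dots> \<le> c * (1 - F t)"
          using below_a[OF that] c0 by (intro mult_left_mono) auto
        finally show ?thesis .
      qed
      then show "indicator {0..<a} t + ennreal (c * (1 - F t)) * indicator {a..} t
          \<le> ennreal (c * (1 - F t)) * indicator {0..} t"
        using a0 by (auto simp: indicator_def)
    qed
    also have "\<dots> = ennreal c * law_mean M"
      unfolding law_mean_layer_cake[OF M.real_distribution_axioms] F_def[symmetric] using c0
      by (subst nn_integral_cmult[symmetric]) (auto simp: ennreal_mult F_bounds mult.assoc)
    finally show ?thesis .
  qed
  ultimately show thesis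
    using that N by (simp add: c_def)
qed

section \<open>Binary entropy\<close>

lemma binary_entropy_0 [simp]: "binary_entropy 0 = 0"
  by (simp add: binary_entropy_def)

lemma binary_entropy_half [simp]: "binary_entropy (1 / 2) = 1"
  by (simp add: binary_entropy_def log_divide)

lemma binary_entropy_nonneg:
  assumes "0 \<le> x" "x \<le> 1"
  shows "0 \<le> binary_entropy x"
  using neg_mult_log_nonneg[of x] neg_mult_log_nonneg[of "1 - x"] assms
  by (simp add: binary_entropy_def algebra_simps)

text \<open>Gibbs' inequality for two-point laws: the tangent bound \<open>ln u \<le> u - 1\<close>
  is used at both points, and the resulting errors \<open>y - x\<close> and \<open>x - y\<close>
  cancel.\<close>

lemma gibbs_binary:
  assumes "0 \<le> x" "x \<le> 1" "0 < y" "y < 1"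
  shows "binary_entropy x \<le> - x * log 2 y - (1 - x) * log 2 (1 - y)"
proof -
  have tangent: "z * ln w - z * ln z \<le> w - z" if "0 \<le> z" "0 < w" for z w :: real
  proof (cases "z = 0")
    case False
    with that have "z * ln (w / z) \<le> z * (w / z - 1)"
      by (intro mult_left_mono ln_le_minus_one) auto
    with False that show ?thesis
      by (simp add: ln_div algebra_simps)
  qed (use that in simp)
  have "(- x * ln x - (1 - x) * ln (1 - x)) / ln 2 \<le> (- x * ln y - (1 - x) * ln (1 - y)) / ln 2"
    using tangent[of x y] tangent[of "1 - x" "1 - y"] assms by (intro divide_right_mono) auto
  then show ?thesis
    by (simp add: binary_entropy_def log_def diff_divide_distrib)
qed

lemma binary_entropy_mono:
  assumes "0 \<le> x" "x \<le> y" "y \<le> 1 / 2"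
  shows "binary_entropy x \<le> binary_entropy y"
proof (cases "x = 0")
  case True
  then show ?thesis using assms binary_entropy_nonneg[of y] by simp
next
  case False
  have "binary_entropy x \<le> - x * log 2 y - (1 - x) * log 2 (1 - y)"
    using assms False by (intro gibbs_binary) auto
  also have "\<dots> = binary_entropy y - (y - x) * (log 2 (1 - y) - log 2 y)"
    by (simp add: binary_entropy_def algebra_simps)
  also have "\<dots> \<le> binary_entropy y"
    using assms False by simp
  finally show ?thesis .
qed

lemma binary_entropy_le_1:
  assumes "0 \<le> x" "x \<le> 1"
  shows "binary_entropy x \<le> 1"
  using gibbs_binary[of x "1 / 2"] assms by (simp add: log_divide algebra_simps)

section \<open>Discretising a law\<close>

text \<open>
  The atoms of a law dominating \<open>M\<close> in self-information are chosen greedily: given the mass \<open>u\<close>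
  already used, the next atom is the largest \<open>l\<close> with \<open>u + l \<le> F (- log l)\<close>.  Maximality means
  that at least the mass that remains afterwards lies above \<open>- log l\<close>.
\<close>

lemma greedy_atom:
  assumes M: "nonneg_law M" and u: "0 \<le> u" "u \<le> 1"
  obtains l where "0 \<le> l" "l \<le> 1" "l > 0 \<Longrightarrow> u + l \<le> cdf M (- log 2 l)"
    "l > 0 \<Longrightarrow> 1 - (u + l) \<le> measure M {- log 2 l..}"
    "\<And>l'. 0 < l' \<Longrightarrow> l' \<le> 1 \<Longrightarrow> u + l' \<le> cdf M (- log 2 l') \<Longrightarrow> l' \<le> l"
proof -
  interpret real_distribution M using M by (rule nonneg_lawD)
  define A where "A = {l. 0 \<le> l \<and> l \<le> 1 \<and> (l = 0 \<or> u + l \<le> cdf M (- log 2 l))}"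
  define l where "l = Sup A"
  have A0: "0 \<in> A" by (simp add: A_def)
  have bdd: "bdd_above A" by (rule bdd_aboveI[of _ 1]) (simp add: A_def)
  have upper: "l' \<le> l" if "l' \<in> A" for l'
    unfolding l_def using that bdd by (rule cSup_upper)
  have l0: "0 \<le> l" using upper A0 .
  have l1: "l \<le> 1"
    unfolding l_def using A0 by (intro cSup_least) (blast, simp add: A_def)
  \<comment> \<open>For \<open>t > - log 2 l\<close> some \<open>l'\<close> in \<open>A\<close>
    exceeds \<open>2 powr (- t)\<close>, which gives \<open>u + 2 powr (- t) \<le> cdf M t\<close>.
    Right continuity of the cdf allows \<open>t\<close> to decrease to
    \<open>- log 2 l\<close>.\<close>
  have attained: "u + l \<le> cdf M (- log 2 l)" if "l > 0"
  proof (rule tendsto_le)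
    show "((\<lambda>t. u + 2 powr (- t)) \<longlongrightarrow> u + l) (at_right (- log 2 l))"
      using that by (auto intro!: tendsto_eq_intros)
    show "(cdf M \<longlongrightarrow> cdf M (- log 2 l)) (at_right (- log 2 l))"
      using cdf_is_right_cont by (simp add: continuous_within)
    show "\<forall>\<^sub>F t in at_right (- log 2 l). u + 2 powr (- t) \<le> cdf M t"
      unfolding eventually_at_right_field
    proof (intro exI[of _ "- log 2 l + 1"] conjI allI impI)
      fix t assume t: "- log 2 l < t"
      then have "2 powr (- t) < l"
        using that by (subst powr_less_iff) auto
      then obtain l' where l': "l' \<in> A" "2 powr (- t) < l'"
        unfolding l_def using less_cSup_iff[OF _ bdd] A0 by blast
      then have "l' > 0"
        using powr_gt_zero[of 2 "- t"] by linarith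
      then have "u + 2 powr (- t) \<le> cdf M (- log 2 l')"
        using l' by (auto simp: A_def)
      also have "- log 2 l' \<le> t"
        using l' \<open>l' > 0\<close> by (simp add: powr_less_iff) 
      finally show "u + 2 powr (- t) \<le> cdf M t"
        by (simp add: cdf_nondecreasing)
    qed simp
  qed simp
  \<comment> \<open>For \<open>0 \<le> t < - log 2 l\<close> maximality excludes
    \<open>2 powr (- t)\<close> from \<open>A\<close>, and for \<open>t < 0\<close> there is no
    mass. Hence \<open>cdf M t \<le> u + 2 powr (- t)\<close>, and \<open>t\<close> increases to
    \<open>- log 2 l\<close>.\<close>
  have "1 - (u + l) \<le> measure M {- log 2 l..}" if "l > 0"
  proof -
    have "measure M {..<- log 2 l} \<le> u + l"
    proof (rule tendsto_le)
      show "(cdf M \<longlongrightarrow> measure M {..<- log 2 l}) (at_left (- log 2 l))"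
        by (rule cdf_at_left)
      show "((\<lambda>t. u + 2 powr (- t)) \<longlongrightarrow> u + l) (at_left (- log 2 l))"
        using that by (auto intro!: tendsto_eq_intros)
      show "\<forall>\<^sub>F t in at_left (- log 2 l). cdf M t \<le> u + 2 powr (- t)"
        unfolding eventually_at_left_field
      proof (intro exI[of _ "- log 2 l - 1"] conjI allI impI)
        fix t assume t: "t < - log 2 l"
        show "cdf M t \<le> u + 2 powr (- t)"
        proof (cases "t < 0")
          case True
          have "cdf M t = 0"
            unfolding cdf_def using M True
            by (subst prob_eq_0) (auto simp: nonneg_law_def elim!: AE_mp)
          then show ?thesis using u by simp
        next
          case False
          have "l < 2 powr (- t)"
            using t that by (subst less_powr_iff) auto
          then have "2 powr (- t) \<notin> A"
            using upper by fastforce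
          moreover have "2 powr (- t) \<le> 1"
            using False powr_mono[of "- t" 0 2] by simp
          ultimately show ?thesis
            by (simp add: A_def)
        qed
      qed simp
    qed simp
    moreover have "measure M {- log 2 l..} = 1 - measure M {..<- log 2 l}"
      using prob_compl[of "{..<- log 2 l}"] by (simp add: Compl_eq_Diff_UNIV[symmetric])
    ultimately show ?thesis by simp
  qed
  then show thesis
    using that[of l] l0 l1 attained upper by (auto simp: A_def)
qed

text \<open>The greedy choice is iterated from \<open>u = 0\<close>. An atom that fits later also
  fits earlier, when less mass is used, so the atoms decrease.\<close>

lemma greedy_partition:
  assumes M: "nonneg_law M"
  obtains l :: "nat \<Rightarrow> real" where "\<And>i. 0 \<le> l i" "decseq l" "l sums 1"
    "\<And>i. l i > 0 \<Longrightarrow> (\<Sum>j\<le>i. l j) \<le> cdf M (- log 2 (l i))"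
    "\<And>i. l i > 0 \<Longrightarrow> 1 - (\<Sum>j\<le>i. l j) \<le> measure M {- log 2 (l i)..}"
proof -
  interpret real_distribution M using M by (rule nonneg_lawD)
  have "\<forall>u. \<exists>l. 0 \<le> u \<and> u \<le> 1 \<longrightarrow> 0 \<le> l \<and> l \<le> 1 \<and> (l > 0 \<longrightarrow> u + l \<le> cdf M (- log 2 l))
      \<and> (l > 0 \<longrightarrow> 1 - (u + l) \<le> measure M {- log 2 l..})
      \<and> (\<forall>l'. 0 < l' \<longrightarrow> l' \<le> 1 \<longrightarrow> u + l' \<le> cdf M (- log 2 l') \<longrightarrow> l' \<le> l)"
    using greedy_atom[OF M] by metis
  then obtain g where g: "\<And>u. 0 \<le> u \<Longrightarrow> u \<le> 1 \<Longrightarrow> 0 \<le> g u \<and> g u \<le> 1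
      \<and> (g u > 0 \<longrightarrow> u + g u \<le> cdf M (- log 2 (g u)))
      \<and> (g u > 0 \<longrightarrow> 1 - (u + g u) \<le> measure M {- log 2 (g u)..})
      \<and> (\<forall>l'. 0 < l' \<longrightarrow> l' \<le> 1 \<longrightarrow> u + l' \<le> cdf M (- log 2 l') \<longrightarrow> l' \<le> g u)"
    by metis
  define u where "u = rec_nat 0 (\<lambda>_ v. v + g v)"
  have u_simps: "u 0 = 0" "u (Suc i) = u i + g (u i)" for i
    by (simp_all add: u_def)
  define l where "l i = g (u i)" for i
  have u: "0 \<le> u i \<and> u i \<le> 1" for i
  proof (induction i)
    case (Suc i)
    then show ?case
      using g[of "u i"] cdf_bounded_prob[of "- log 2 (g (u i))"]
      by (cases "g (u i) > 0") (auto simp: u_simps intro: order_trans)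
  qed (simp add: u_simps)
  note gu = g[OF conjunct1[OF u] conjunct2[OF u], folded l_def]
  have u_sum: "u i = (\<Sum>j<i. l j)" for i
    by (induction i) (simp_all add: u_simps l_def)
  then have u_Suc: "u i + l i = (\<Sum>j\<le>i. l j)" for i
    by (simp add: lessThan_Suc_atMost[symmetric])
  have "l (Suc i) \<le> l i" for i
  proof (cases "l (Suc i) > 0")
    case True
    have "u i + l (Suc i) \<le> u (Suc i) + l (Suc i)"
      using gu[of i] by (simp add: u_simps l_def)
    also have "\<dots> \<le> cdf M (- log 2 (l (Suc i)))"
      using gu[of "Suc i"] True by simp
    finally show ?thesis
      using gu[of i] gu[of "Suc i"] True by blast
  next
    case False
    then show ?thesis using gu[of i] by linarith
  qed
  then have dec: "decseq l" by (rule decseq_SucI)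
  have summable: "summable l"
    using gu u by (intro summableI_nonneg_bounded[of _ 1]) (auto simp: u_sum)
  have "suminf l = 1"
  proof (rule ccontr)
    assume "suminf l \<noteq> 1"
    moreover have "suminf l \<le> 1"
      using summable u by (intro suminf_le_const) (auto simp: u_sum)
    ultimately have less: "suminf l < 1" by simp
    define v where "v = (1 - suminf l) / 2"
    have "\<forall>\<^sub>F t in at_top. 1 - v < cdf M t"
      using less by (intro order_tendstoD(1)[OF cdf_lim_at_top_prob]) (simp add: v_def)
    moreover have "((\<lambda>t. 2 powr (- t)) \<longlongrightarrow> (0::real)) at_top"
      by real_asymp
    then have "\<forall>\<^sub>F t in at_top. 2 powr (- t) < v"
      using less by (intro order_tendstoD(2)) (auto simp: v_def)
    ultimately have "\<forall>\<^sub>F t in at_top. 1 - v < cdf M t \<and> 2 powr (- t) < v \<and> t \<ge> 0"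
      by (intro eventually_conj eventually_ge_at_top)
    then obtain t where t: "1 - v < cdf M t" "2 powr (- t) < v" "t \<ge> 0"
      unfolding eventually_at_top_linorder by blast
    have "2 powr (- t) \<le> l i" for i
    proof -
      have "u i \<le> suminf l"
        using summable gu by (auto simp: u_sum intro!: sum_le_suminf)
      then have "u i + 2 powr (- t) \<le> cdf M (- log 2 (2 powr (- t)))"
        using t by (simp add: v_def field_simps)
      moreover have "2 powr (- t) \<le> 1"
        using t powr_mono[of "- t" 0 2] by simp
      ultimately show ?thesis
        using gu[of i] powr_gt_zero[of 2 "- t"] by auto
    qed
    moreover have "l \<longlonglongrightarrow> 0"
      using summable by (rule summable_LIMSEQ_zero)
    ultimately have "2 powr (- t) \<le> 0"
      by (intro LIMSEQ_le_const) auto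
    then show False by simp
  qed
  then have "l sums 1"
    using summable summable_sums by metis
  then show thesis
    using that[of l] gu dec by (simp add: u_Suc[symmetric])
qed


lemma decseq_sums_1_pos:
  fixes l :: "nat \<Rightarrow> real"
  assumes "\<And>i. 0 \<le> l i" "decseq l" "l sums 1"
  shows "0 < l 0"
proof (rule ccontr)
  assume "\<not> 0 < l 0"
  then have "l i = 0" for i
    using assms(1)[of i] decseqD[OF assms(2), of 0 i] by linarith
  then have "l = (\<lambda>_. 0)"
    by (rule ext)
  then show False
    using assms(3) sums_unique2[OF sums_zero] by fastforce
qed

text \<open>By \<open>tail\<close>, \<open>M\<close> lies stochastically above the law that puts
  \<open>l 0\<close> at 0 and \<open>l (Suc j)\<close> at \<open>- log 2 (l j)\<close>, charging
  each atom with the self-information of its predecessor. The first bound compares the means, the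
  second uses the lowest level only.\<close>

lemma greedy_mean:
  assumes M: "nonneg_law M" "law_mean M = ennreal m" "0 \<le> m"
    and l: "\<And>i. 0 \<le> l i" "decseq l" "l sums 1"
    and tail: "\<And>i. l i > 0 \<Longrightarrow> 1 - (\<Sum>j\<le>i. l j) \<le> measure M {- log 2 (l i)..}"
  shows "(\<Sum>j<N. l (Suc j) * - log 2 (l j)) \<le> m" "(1 - l 0) * - log 2 (l 0) \<le> m"
proof -
  interpret real_distribution M using M by (simp add: nonneg_lawD)
  define \<iota> where "\<iota> i = - log 2 (l i)" for i
  have nonneg: "AE x in M. 0 \<le> x"
    using M by (simp add: nonneg_law_def)
  have int: "integrable M (\<lambda>x. x)"
    using M nonneg by (intro integrableI_nonneg) (auto simp: law_mean_def)
  have m: "(\<integral>x. x \<partial>M) = m"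
    using M nonneg by (simp add: integral_eq_nn_integral law_mean_def)
  have int_min: "integrable M (\<lambda>x. min x c)" for c
    using int by simp
  have sum_le: "(\<Sum>j\<in>I. l j) \<le> 1" if "finite I" for I
    using sum_le_suminf[of l I] l that by (auto simp: sums_iff)
  have l_le: "l i \<le> 1" for i
    using sum_le[of "{i}"] by simp
  have \<iota>0: "0 \<le> \<iota> i" if "l i > 0" for i
    using l_le[of i] that by (simp add: \<iota>_def)
  \<comment> \<open>The integrand \<open>min x c' - min x c\<close> is \<open>c' - c\<close> on
    \<open>{c'..}\<close> and nonnegative elsewhere.\<close>
  have step: "(c' - c) * measure M {c'..} \<le> (\<integral>x. min x c' \<partial>M) - (\<integral>x. min x c \<partial>M)"
    if "c \<le> c'" for c c'
  proof -
    have "(c' - c) * measure M {c'..} = (\<integral>x. (c' - c) * indicator {c'..} x \<partial>M)"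
      by simp
    also have "\<dots> \<le> (\<integral>x. min x c' - min x c \<partial>M)"
    proof (rule integral_mono)
      show "integrable M (\<lambda>x. (c' - c) * indicator {c'..} x)"
        by (intro integrable_mult_right integrable_real_indicator) (auto simp: emeasure_eq_measure)
      show "integrable M (\<lambda>x. min x c' - min x c)"
        using int_min by simp
    qed (use that in \<open>auto simp: indicator_def\<close>)
    also have "\<dots> = (\<integral>x. min x c' \<partial>M) - (\<integral>x. min x c \<partial>M)"
      using int_min by simp
    finally show ?thesis .
  qed
  have min_le: "(\<integral>x. min x c \<partial>M) \<le> m" for c
    unfolding m[symmetric] using int int_min by (intro integral_mono) auto
  \<comment> \<open>Summation by parts against truncated means: the mass not yet used is placed at
    level \<open>\<iota> N\<close>, and passing to \<open>\<iota> (Suc N)\<close> adds one layer,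
    bounded by \<open>step\<close>.\<close>
  have partial: "(\<Sum>j<N. l (Suc j) * \<iota> j) + (1 - (\<Sum>j\<le>N. l j)) * \<iota> N \<le> (\<integral>x. min x (\<iota> N) \<partial>M)"
    if "l N > 0" for N
    using that
  proof (induction N)
    case 0
    have "(1 - l 0) * \<iota> 0 \<le> measure M {\<iota> 0..} * \<iota> 0"
      using tail[of 0] 0 \<iota>0[of 0] by (intro mult_right_mono) (auto simp: \<iota>_def)
    also have "\<dots> \<le> (\<integral>x. min x (\<iota> 0) \<partial>M) - (\<integral>x. min x 0 \<partial>M)"
      using step[of 0 "\<iota> 0"] \<iota>0[of 0] 0 by (simp add: mult.commute)
    also have "(\<integral>x. min x 0 \<partial>M) = (\<integral>x. 0 \<partial>M)"
      using nonneg by (intro integral_cong_AE) auto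
    finally show ?case by simp
  next
    case (Suc N)
    have "l (Suc N) \<le> l N"
      using l(2) by (simp add: decseq_Suc_iff)
    then have lN: "l N > 0" and mono: "\<iota> N \<le> \<iota> (Suc N)"
      using Suc.prems by (auto simp: \<iota>_def)
    have "(\<Sum>j<Suc N. l (Suc j) * \<iota> j) + (1 - (\<Sum>j\<le>Suc N. l j)) * \<iota> (Suc N)
        = (\<Sum>j<N. l (Suc j) * \<iota> j) + (1 - (\<Sum>j\<le>N. l j)) * \<iota> N
          + (\<iota> (Suc N) - \<iota> N) * (1 - (\<Sum>j\<le>Suc N. l j))"
      by (simp add: algebra_simps)
    also have "\<dots> \<le> (\<integral>x. min x (\<iota> N) \<partial>M) + (\<iota> (Suc N) - \<iota> N) * measure M {\<iota> (Suc N)..}"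
      using Suc.IH[OF lN] tail[OF Suc.prems] mono
      by (intro add_mono mult_left_mono) (auto simp: \<iota>_def)
    also have "\<dots> \<le> (\<integral>x. min x (\<iota> (Suc N)) \<partial>M)"
      using step[OF mono] by simp
    finally show ?case .
  qed
  have "(\<Sum>j<N. l (Suc j) * \<iota> j) \<le> m"
  proof (induction N)
    case 0
    then show ?case using M by simp
  next
    case (Suc N)
    have "l (Suc N) = 0 \<or> l (Suc N) > 0"
      using l(1)[of "Suc N"] by linarith
    then show ?case
    proof
      assume "l (Suc N) = 0"
      with Suc.IH show ?thesis by simp
    next
      assume pos: "l (Suc N) > 0"
      have "0 \<le> (1 - (\<Sum>j\<le>Suc N. l j)) * \<iota> (Suc N)"
        using sum_le[of "{..Suc N}"] \<iota>0[OF pos] by (intro mult_nonneg_nonneg) auto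
      moreover have "0 \<le> l (Suc N)" by (rule l)
      moreover have "l (Suc N) \<le> l N"
        using l(2) by (simp add: decseq_Suc_iff)
      then have "\<iota> N \<le> \<iota> (Suc N)"
        using pos by (simp add: \<iota>_def)
      ultimately show ?thesis
        using partial[OF pos] min_le[of "\<iota> (Suc N)"] by linarith
    qed
  qed
  then show "(\<Sum>j<N. l (Suc j) * - log 2 (l j)) \<le> m"
    by (simp add: \<iota>_def)
  have "l 0 > 0"
    using decseq_sums_1_pos[OF l] .
  then show "(1 - l 0) * - log 2 (l 0) \<le> m"
    using partial[of 0] min_le[of "\<iota> 0"] by (simp add: \<iota>_def)
qed

text \<open>
  With \<open>\<delta> = 1 - l 0\<close>, the excess of the entropy over the mean is at most
  \<open>l 0 * log (1 / l 0)\<close> plus the sum of all \<open>l (j + 1) * log (l j / l (j + 1))\<close>, and the concavity of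
  the logarithm bounds this sum by \<open>\<delta> * log (1 / \<delta>)\<close>.
\<close>

lemma greedy_entropy:
  assumes l: "\<And>i. 0 \<le> l i" "decseq l" "l sums 1"
    and mean: "\<And>N. (\<Sum>j<N. l (Suc j) * - log 2 (l j)) \<le> m"
  shows "(\<Sum>i<K. - l i * log 2 (l i)) \<le> m + binary_entropy (1 - l 0)"
proof -
  define \<delta> where "\<delta> = 1 - l 0"
  define S where "S N = (\<Sum>j<N. l (Suc j))" for N
  have sum_le: "(\<Sum>j\<in>I. l j) \<le> 1" if "finite I" for I
    using sum_le_suminf[of l I] l that by (auto simp: sums_iff)
  have l_le: "l i \<le> 1" for i
    using sum_le[of "{i}"] by simp
  have S_lim: "S \<longlonglongrightarrow> \<delta>"
    using l(3) sums_Suc_iff[of l \<delta>] by (simp add: S_def[abs_def] \<delta>_def sums_def)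
  have S_le: "S N \<le> \<delta>" for N
    using sum_le[of "{..<Suc N}"] by (simp add: S_def \<delta>_def sum.lessThan_Suc_shift del: sum.lessThan_Suc)
  have \<delta>: "0 \<le> \<delta>" "\<delta> \<le> 1"
    using l(1)[of 0] l_le[of 0] by (auto simp: \<delta>_def)
  \<comment> \<open>This is \<open>ln u \<le> u - 1\<close> at
    \<open>u = \<delta> * l j / l (Suc j)\<close>. The last terms add up to at most
    \<open>(\<delta> - S N) / ln 2\<close>, which vanishes in the limit.\<close>
  have term_le: "- l (Suc j) * log 2 (l (Suc j))
      \<le> l (Suc j) * - log 2 (l j) + l (Suc j) * - log 2 \<delta> + (\<delta> * l j - l (Suc j)) / ln 2" for j
  proof (cases "l (Suc j) = 0")
    case True
    then show ?thesis using l(1)[of j] \<delta> by simp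
  next
    case False
    then have x: "l (Suc j) > 0" using l(1)[of "Suc j"] by simp
    then have y: "l j > 0"
      using l(2) by (auto simp: decseq_Suc_iff intro: less_le_trans)
    have d: "\<delta> > 0"
      using S_le[of "Suc j"] x sum_nonneg[of "{..<j}" "\<lambda>j. l (Suc j)"] l(1) by (simp add: S_def)
    have "ln (\<delta> * l j / l (Suc j)) \<le> \<delta> * l j / l (Suc j) - 1"
      using x y d by (intro ln_le_minus_one) auto
    then have "l (Suc j) * ln (\<delta> * l j / l (Suc j)) \<le> \<delta> * l j - l (Suc j)"
      using x by (simp add: field_simps)
    then have "l (Suc j) * (ln \<delta> + ln (l j) - ln (l (Suc j))) \<le> \<delta> * l j - l (Suc j)"
      using x y d by (simp add: ln_mult ln_div)
    then have "l (Suc j) * (ln \<delta> + ln (l j) - ln (l (Suc j))) / ln 2 \<le> (\<delta> * l j - l (Suc j)) / ln 2"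
      by (intro divide_right_mono) auto
    then show ?thesis
      by (simp add: log_def diff_divide_distrib add_divide_distrib algebra_simps)
  qed
  have partial: "(\<Sum>i<Suc N. - l i * log 2 (l i)) \<le> m + binary_entropy \<delta> + (\<delta> - S N) / ln 2" for N
  proof -
    have "(\<Sum>j<N. - l (Suc j) * log 2 (l (Suc j)))
        \<le> (\<Sum>j<N. l (Suc j) * - log 2 (l j) + l (Suc j) * - log 2 \<delta> + (\<delta> * l j - l (Suc j)) / ln 2)"
      by (intro sum_mono term_le)
    also have "\<dots> = (\<Sum>j<N. l (Suc j) * - log 2 (l j)) + S N * - log 2 \<delta>
        + (\<delta> * (\<Sum>j<N. l j) - S N) / ln 2"
      by (simp add: sum.distrib S_def sum_distrib_left sum_distrib_right sum_divide_distrib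
          sum_subtractf sum_negf diff_divide_distrib)
    also have "\<dots> \<le> m + \<delta> * - log 2 \<delta> + (\<delta> * 1 - S N) / ln 2"
    proof (intro add_mono mean divide_right_mono diff_mono mult_left_mono mult_right_mono S_le sum_le)
      show "0 \<le> - log 2 \<delta>"
        using \<delta> by (cases "\<delta> = 0") (auto simp: log_def intro!: divide_nonpos_pos)
    qed (use \<delta> in auto)
    finally show ?thesis
      by (simp add: sum.lessThan_Suc_shift binary_entropy_def \<delta>_def algebra_simps del: sum.lessThan_Suc)
  qed
  have "(\<lambda>N. m + binary_entropy \<delta> + (\<delta> - S N) / ln 2) \<longlonglongrightarrow> m + binary_entropy \<delta> + (\<delta> - \<delta>) / ln 2"
    by (intro tendsto_intros S_lim) auto
  moreover have "(\<Sum>i<K. - l i * log 2 (l i)) \<le> m + binary_entropy \<delta> + (\<delta> - S N) / ln 2"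
    if "K \<le> N" for N
  proof -
    have nonneg: "0 \<le> - l i * log 2 (l i)" for i
      by (intro neg_mult_log_nonneg l(1) l_le)
    have "(\<Sum>i<K. - l i * log 2 (l i)) \<le> (\<Sum>i<Suc N. - l i * log 2 (l i))"
      using that nonneg by (intro sum_mono2) auto
    also note partial
    finally show ?thesis .
  qed
  ultimately show ?thesis
    using LIMSEQ_le_const[of _ "m + binary_entropy \<delta>"] by (auto simp: \<delta>_def)
qed

lemma exists_discretization:
  assumes M: "nonneg_law M" "law_mean M = ennreal m" "0 \<le> m"
  obtains W :: "nat pmf" where "info_spectrum_cdf W \<le> cdf M"
    "shannon_entropy W \<le> ennreal (m + binary_entropy (min (sqrt (m * ln 2)) (1 / 2)))"
proof -
  interpret real_distribution M using M by (simp add: nonneg_lawD)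
  obtain l where l: "\<And>i. 0 \<le> l i" "decseq l" "l sums 1"
    and below: "\<And>i. l i > 0 \<Longrightarrow> (\<Sum>j\<le>i. l j) \<le> cdf M (- log 2 (l i))"
    and tail: "\<And>i. l i > 0 \<Longrightarrow> 1 - (\<Sum>j\<le>i. l j) \<le> measure M {- log 2 (l i)..}"
    using greedy_partition[OF M(1)] by blast
  note mean = greedy_mean[OF M l tail]
  note entropy = greedy_entropy[OF l mean(1)]
  define W where "W = embed_pmf l"
  have "(\<integral>\<^sup>+i. ennreal (l i) \<partial>count_space UNIV) = 1"
    using suminf_ennreal_eq[OF l(1,3)] by (simp add: nn_integral_count_space_nat)
  then have W: "pmf W i = l i" for i
    unfolding W_def using l by (intro pmf_embed_pmf) auto
  have l_le: "l i \<le> 1" for i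
    using pmf_le_1[of W i] by (simp add: W)
  have l0: "l 0 > 0"
    using decseq_sums_1_pos[OF l] .
  have "info_spectrum_cdf W \<le> cdf M"
  proof (rule le_funI)
    fix t
    define B where "B = {i. - log 2 (l i) \<le> t}"
    have "(\<lambda>i. pmf W i * indicator B i) sums measure_pmf.prob W B"
    proof -
      have "(\<lambda>i. measure_pmf.prob W (B \<inter> {i})) sums measure_pmf.prob W (\<Union>i. B \<inter> {i})"
        by (intro measure_pmf.finite_measure_UNION) (auto simp: disjoint_family_on_def)
      moreover have "measure_pmf.prob W (B \<inter> {i}) = pmf W i * indicator B i" for i
        by (cases "i \<in> B") (auto simp: measure_pmf_single)
      moreover have "(\<Union>i. B \<inter> {i}) = B"
        by auto
      ultimately show ?thesis by simp
    qed
    \<comment> \<open>The last index in \<open>B\<close> of positive mass decides: it and all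
      earlier atoms together weigh at most \<open>cdf M (- log 2 (l N)) \<le> cdf M t\<close>.
      Indices of mass 0 may lie in \<open>B\<close>, because \<open>log 2 0 = 0\<close>, but add
      nothing.\<close>
    moreover have "(\<Sum>i<N. pmf W i * indicator B i) \<le> cdf M t" for N
    proof (induction N)
      case 0
      then show ?case by (simp add: cdf_nonneg)
    next
      case (Suc N)
      show ?case
      proof (cases "l N > 0 \<and> N \<in> B")
        case True
        have "(\<Sum>i<Suc N. pmf W i * indicator B i) \<le> (\<Sum>i\<le>N. l i)"
          unfolding lessThan_Suc_atMost W using l(1) by (intro sum_mono) (auto simp: indicator_def)
        also have "\<dots> \<le> cdf M (- log 2 (l N))"
          using True below by simp
        also have "\<dots> \<le> cdf M t"
          using True by (intro cdf_nondecreasing) (simp add: B_def)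
        finally show ?thesis .
      next
        case False
        then have "pmf W N * indicator B N = 0"
          using l(1)[of N] by (auto simp: W indicator_def)
        with Suc.IH show ?thesis
          unfolding sum.lessThan_Suc by linarith
      qed
    qed
    ultimately have "measure_pmf.prob W B \<le> cdf M t"
      unfolding sums_def by (intro LIMSEQ_le_const2) auto
    then show "info_spectrum_cdf W t \<le> cdf M t"
      by (simp add: info_spectrum_cdf_def self_info_def W B_def)
  qed
  moreover have "shannon_entropy W \<le> ennreal (m + binary_entropy (1 - l 0))"
  proof -
    have "shannon_entropy W = (\<Sum>i. ennreal (- l i * log 2 (l i)))"
      by (simp add: shannon_entropy_def W nn_integral_count_space_nat)
    also have "\<dots> \<le> ennreal (m + binary_entropy (1 - l 0))"
    proof (rule suminf_le_const)
      fix N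
      have nonneg: "0 \<le> - l i * log 2 (l i)" for i
        by (intro neg_mult_log_nonneg l(1) l_le)
      have "(\<Sum>i<N. ennreal (- l i * log 2 (l i))) = ennreal (\<Sum>i<N. - l i * log 2 (l i))"
        using nonneg by (intro sum_ennreal) 
      also have "\<dots> \<le> ennreal (m + binary_entropy (1 - l 0))"
        by (intro ennreal_leI entropy)
      finally show "(\<Sum>i<N. ennreal (- l i * log 2 (l i))) \<le> ennreal (m + binary_entropy (1 - l 0))" .
    qed simp
    finally show ?thesis .
  qed
  moreover have "binary_entropy (1 - l 0) \<le> binary_entropy (min (sqrt (m * ln 2)) (1 / 2))"
  proof -
    define \<delta> where "\<delta> = 1 - l 0"
    have \<delta>: "0 \<le> \<delta>" "\<delta> < 1"
      using l_le[of 0] l0 by (auto simp: \<delta>_def)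
    \<comment> \<open>With \<open>- ln (1 - \<delta>) \<ge> \<delta>\<close>, the second bound of
      \<open>greedy_mean\<close> becomes \<open>\<delta>^2 \<le> m * ln 2\<close>. If the root
      exceeds \<open>1 / 2\<close>, the entropy is bounded by its maximum 1 instead.\<close>
    have "\<delta> * \<delta> \<le> \<delta> * - ln (1 - \<delta>)"
      using ln_le_minus_one[of "1 - \<delta>"] \<delta> by (intro mult_left_mono) auto
    also have "\<dots> = (\<delta> * - log 2 (1 - \<delta>)) * ln 2"
      by (simp add: log_def)
    also have "\<dots> \<le> m * ln 2"
      using mean(2) by (intro mult_right_mono) (auto simp: \<delta>_def)
    finally have le: "\<delta> \<le> sqrt (m * ln 2)"
      using \<delta> by (simp add: real_le_rsqrt power2_eq_square)
    have "binary_entropy \<delta> \<le> binary_entropy (min (sqrt (m * ln 2)) (1 / 2))"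
    proof (cases "sqrt (m * ln 2) \<le> 1 / 2")
      case True
      then show ?thesis using le \<delta> by (intro binary_entropy_mono) auto
    next
      case False
      then show ?thesis using binary_entropy_le_1[of \<delta>] \<delta> by (simp add: min_def)
    qed
    then show ?thesis by (simp add: \<delta>_def)
  qed
  ultimately show thesis
    using that[of W] by (meson add_left_mono ennreal_leI order_trans)
qed

section \<open>Functions of a dominating variable and a coin\<close>

text \<open>
  The slots are adjacent intervals that tile \<open>[0, 1)\<close> up to a null set, in order of decreasing
  probability; the enumeration only breaks ties.
\<close>

definition precedes :: "'a pmf \<Rightarrow> 'a \<Rightarrow> 'a \<Rightarrow> bool" where
  "precedes p y x \<longleftrightarrow> y \<in> set_pmf p \<and> (pmf p y > pmf p x \<or>
     pmf p y = pmf p x \<and> to_nat_on (set_pmf p) y < to_nat_on (set_pmf p) x)"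

definition slot_start :: "'a pmf \<Rightarrow> 'a \<Rightarrow> real" where
  "slot_start p x = measure_pmf.prob p {y. precedes p y x}"

definition slot :: "'a pmf \<Rightarrow> 'a \<Rightarrow> real set" where
  "slot p x = {slot_start p x..<slot_start p x + pmf p x}"

lemma precedes_linear:
  assumes "x \<in> set_pmf p" "y \<in> set_pmf p" "x \<noteq> y"
  shows "precedes p x y \<or> precedes p y x"
proof -
  have "to_nat_on (set_pmf p) x \<noteq> to_nat_on (set_pmf p) y"
    using assms inj_on_to_nat_on[OF countable_set_pmf] by (auto dest: inj_onD)
  then consider "to_nat_on (set_pmf p) x < to_nat_on (set_pmf p) y"
    | "to_nat_on (set_pmf p) y < to_nat_on (set_pmf p) x"
    by linarith
  then show ?thesis
    by cases (use assms in \<open>simp add: precedes_def; linarith\<close>)+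
qed

lemma slot_start_add_le:
  assumes "insert x {y. precedes p y x} \<subseteq> B"
  shows "slot_start p x + pmf p x \<le> measure_pmf.prob p B"
proof -
  have "slot_start p x + pmf p x = measure_pmf.prob p ({y. precedes p y x} \<union> {x})"
    unfolding slot_start_def measure_pmf_single[symmetric]
    by (rule measure_pmf.finite_measure_Union[symmetric]) (auto simp: precedes_def)
  also have "\<dots> \<le> measure_pmf.prob p B"
    using assms by (intro measure_pmf.finite_measure_mono) auto
  finally show ?thesis .
qed

lemma slot_order:
  assumes "precedes p x y"
  shows "slot_start p x + pmf p x \<le> slot_start p y"
  unfolding slot_start_def[of p y] using assms
  by (intro slot_start_add_le) (auto simp: precedes_def)

lemma slot_empty: "x \<notin> set_pmf p \<Longrightarrow> slot p x = {}"
  by (simp add: slot_def set_pmf_iff)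

lemma slot_subset: "slot p x \<subseteq> {0..<1}"
  using slot_start_add_le[of x p UNIV] by (auto simp: slot_def slot_start_def intro: order_trans)

lemma emeasure_slot: "emeasure lborel (slot p x) = ennreal (pmf p x)"
  by (simp add: slot_def)

lemma sets_slot [measurable]: "slot p x \<in> sets borel"
  by (simp add: slot_def)

lemma disjoint_slots: "disjoint_family_on (slot p) (set_pmf p)"
  unfolding disjoint_family_on_def
proof (intro ballI impI)
  fix x y assume "x \<in> set_pmf p" "y \<in> set_pmf p" "x \<noteq> y"
  then have "slot_start p x + pmf p x \<le> slot_start p y \<or> slot_start p y + pmf p y \<le> slot_start p x"
    using precedes_linear[of x p y] slot_order by metis
  then show "slot p x \<inter> slot p y = {}"
    by (auto simp: slot_def)
qed

lemma slots_cover: "emeasure lborel ({0..<1} - (\<Union>x\<in>set_pmf p. slot p x)) = 0"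
proof -
  have "emeasure lborel (\<Union>x\<in>set_pmf p. slot p x)
      = (\<integral>\<^sup>+x. emeasure lborel (slot p x) \<partial>count_space (set_pmf p))"
    by (intro emeasure_UN_countable countable_set_pmf disjoint_slots) simp
  also have "\<dots> = 1"
    by (simp add: emeasure_slot nn_integral_pmf emeasure_pmf)
  finally have "emeasure lborel (\<Union>x\<in>set_pmf p. slot p x) = 1" .
  moreover have "(\<Union>x\<in>set_pmf p. slot p x) \<subseteq> {0..<1}"
    by (intro UN_least slot_subset)
  moreover have "(\<Union>x\<in>set_pmf p. slot p x) \<in> sets lborel"
    by (intro sets.countable_UN' countable_set_pmf) auto
  ultimately show ?thesis
    by (subst emeasure_Diff) auto
qed

text \<open>With \<open>A\<close> a slot of another pmf, this gives the marginals of a coupling: the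
  lengths of the overlaps of the slots of \<open>q\<close> and \<open>p\<close> are its joint
  probabilities.\<close>

lemma nn_integral_slots:
  assumes "A \<in> sets borel" "A \<subseteq> {0..<1}"
  shows "(\<integral>\<^sup>+x. emeasure lborel (A \<inter> slot p x) \<partial>count_space UNIV) = emeasure lborel A"
proof -
  let ?U = "\<Union>x\<in>set_pmf p. slot p x"
  have U: "?U \<in> sets lborel"
    by (intro sets.countable_UN' countable_set_pmf) auto
  have "(\<integral>\<^sup>+x. emeasure lborel (A \<inter> slot p x) \<partial>count_space UNIV)
      = (\<integral>\<^sup>+x. emeasure lborel (A \<inter> slot p x) \<partial>count_space (set_pmf p))"
    by (intro nn_integral_count_space_eq) (auto simp: slot_empty)
  also have "\<dots> = emeasure lborel (\<Union>x\<in>set_pmf p. A \<inter> slot p x)"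
    using assms disjoint_slots[of p]
    by (intro emeasure_UN_countable[symmetric] countable_set_pmf)
      (auto simp: disjoint_family_on_def)
  also have "\<dots> = emeasure lborel (A \<inter> ?U)"
    by (intro arg_cong[where f = "emeasure lborel"]) auto
  also have "\<dots> = emeasure lborel (A \<inter> ?U) + emeasure lborel (A - ?U)"
  proof -
    have "emeasure lborel (A - ?U) \<le> emeasure lborel ({0..<1} - ?U)"
      using assms U by (intro emeasure_mono) auto
    then show ?thesis by (simp add: slots_cover)
  qed
  also have "\<dots> = emeasure lborel (A \<inter> ?U \<union> (A - ?U))"
    using assms U by (intro plus_emeasure) auto
  also have "A \<inter> ?U \<union> (A - ?U) = A"
    by auto
  finally show ?thesis .
qed

text \<open>
  Among three atoms of \<open>p\<close> meeting the slot of \<open>z\<close>, the middle one would be strictly inside it, hence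
  smaller than \<open>z\<close>; but then all atoms of \<open>p\<close> that are at least as large as \<open>z\<close> lie to its left and,
  by domination, already cover the slot of \<open>z\<close>.
\<close>

lemma slot_meets_at_most_two:
  assumes dom: "info_spectrum_cdf q \<le> info_spectrum_cdf p" and z: "z \<in> set_pmf q"
    and x: "precedes p x1 x2" "precedes p x2 x3" "x2 \<in> set_pmf p"
    and meet: "slot q z \<inter> slot p x1 \<noteq> {}" "slot q z \<inter> slot p x2 \<noteq> {}" "slot q z \<inter> slot p x3 \<noteq> {}"
  shows False
proof -
  have inside: "slot_start q z < slot_start p x2" "slot_start p x2 + pmf p x2 < slot_start q z + pmf q z"
    using slot_order[OF x(1)] slot_order[OF x(2)] meet(1,3) by (auto simp: slot_def)
  then have less: "pmf p x2 < pmf q z"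
    by simp
  have pos: "pmf p x2 > 0" "pmf q z > 0"
    using x(3) z by (auto simp: pmf_positive)
  define t where "t = - log 2 (pmf q z)"
  have "slot_start q z + pmf q z \<le> info_spectrum_cdf q t"
    unfolding info_spectrum_cdf_def
  proof (rule slot_start_add_le, safe)
    show "self_info q z \<le> t"
      by (simp add: self_info_def t_def)
    fix y assume "precedes q y z"
    then have "pmf q z \<le> pmf q y"
      by (auto simp: precedes_def)
    then show "self_info q y \<le> t"
      using pos by (simp add: self_info_def t_def)
  qed
  also have "\<dots> \<le> info_spectrum_cdf p t"
    using dom by (simp add: le_fun_def)
  \<comment> \<open>Points of mass 0 have self-information 0, as \<open>log 2 0 = 0\<close>; they
    are removed before masses are compared.\<close>
  also have "\<dots> = measure_pmf.prob p ({x. self_info p x \<le> t} \<inter> set_pmf p)"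
    by (simp add: info_spectrum_cdf_def measure_Int_set_pmf)
  also have "\<dots> \<le> slot_start p x2"
    unfolding slot_start_def
  proof (intro measure_pmf.finite_measure_mono subsetI)
    fix y assume y: "y \<in> {x. self_info p x \<le> t} \<inter> set_pmf p"
    then have "pmf p y > 0" by (simp add: pmf_positive)
    then have "pmf q z \<le> pmf p y"
      using y pos by (simp add: self_info_def t_def)
    then show "y \<in> {y. precedes p y x2}"
      using y less by (simp add: precedes_def)
  qed simp
  finally show False
    using meet(2) by (auto simp: slot_def)
qed

text \<open>Since a slot of \<open>q\<close> meets at most two slots of \<open>p\<close>, a single
  event of prescribed probability suffices for each \<open>z\<close>.\<close>

definition bernoulli_universal :: "'a pmf \<Rightarrow> bool" where
  "bernoulli_universal v \<longleftrightarrow> (\<forall>a. 0 \<le> a \<and> a \<le> 1 \<longrightarrow> (\<exists>S. measure_pmf.prob v S = a))"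

lemma exists_two_cover:
  assumes "A \<noteq> {}" "\<And>x y z. x \<in> A \<Longrightarrow> y \<in> A \<Longrightarrow> z \<in> A \<Longrightarrow> x \<noteq> y \<Longrightarrow> y \<noteq> z \<Longrightarrow> x \<noteq> z \<Longrightarrow> False"
  obtains x y where "A = {x, y}"
proof -
  obtain x where x: "x \<in> A" using assms(1) by blast
  show thesis
  proof (cases "A = {x}")
    case True
    then show thesis using that[of x x] by simp
  next
    case False
    then obtain y where y: "y \<in> A" "y \<noteq> x" using x by auto
    then have "A = {x, y}" using x assms(2)[of x y] by auto
    then show thesis by (rule that)
  qed
qed

text \<open>Given \<open>z\<close>, the overlap coupling lives on at most two atoms
  \<open>x1\<close> and \<open>x2\<close>; an event \<open>S\<close> of probability
  \<open>ov x1 / pmf q z\<close> chooses between them.\<close>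

lemma exists_split:
  assumes v: "bernoulli_universal v" and dom: "info_spectrum_cdf q \<le> info_spectrum_cdf p"
    and z: "z \<in> set_pmf q"
  obtains h where "\<And>w. h w \<in> set_pmf p"
    "\<And>x. pmf q z * measure_pmf.prob v {w. h w = x} = measure lborel (slot q z \<inter> slot p x)"
proof -
  define ov where "ov x = measure lborel (slot q z \<inter> slot p x)" for x
  have fin: "emeasure lborel (slot q z \<inter> slot p x) = ennreal (ov x)" for x
  proof -
    have "emeasure lborel (slot q z \<inter> slot p x) \<le> emeasure lborel (slot p x)"
      by (intro emeasure_mono) auto
    then have "emeasure lborel (slot q z \<inter> slot p x) < \<infinity>"
      by (auto simp: emeasure_slot intro: le_less_trans)
    then show ?thesis
      by (simp add: ov_def emeasure_eq_ennreal_measure)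
  qed
  have total: "(\<integral>\<^sup>+x. ennreal (ov x) \<partial>count_space UNIV) = ennreal (pmf q z)"
    using nn_integral_slots[of "slot q z" p] slot_subset[of q z]
    by (simp add: fin emeasure_slot)
  have ov_nonneg: "0 \<le> ov x" for x
    by (simp add: ov_def)
  have pos: "0 < pmf q z"
    using z by (simp add: pmf_positive)
  define A where "A = {x. ov x \<noteq> 0}"
  have meet: "slot q z \<inter> slot p x \<noteq> {}" if "x \<in> A" for x
    using that by (auto simp: A_def ov_def)
  then have A_sub: "A \<subseteq> set_pmf p"
    using slot_empty by fastforce
  have "A \<noteq> {}"
  proof
    assume "A = {}"
    then have "ov x = 0" for x by (auto simp: A_def)
    then show False using total pos by simp
  qed
  moreover have False
    if A: "x \<in> A" "y \<in> A" "w \<in> A" and ne: "x \<noteq> y" "y \<noteq> w" "x \<noteq> w" for x y w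
  proof -
    have *: "\<not> (precedes p a b \<and> precedes p b c)" if "a \<in> A" "b \<in> A" "c \<in> A" for a b c
      using slot_meets_at_most_two[OF dom z _ _ subsetD[OF A_sub that(2)] meet[OF that(1)]
          meet[OF that(2)] meet[OF that(3)]] by auto
    note A' = A[THEN subsetD[OF A_sub]]
    from precedes_linear[OF A'(1,2) ne(1)] precedes_linear[OF A'(2,3) ne(2)]
      precedes_linear[OF A'(1,3) ne(3)] *[OF A(1,2,3)] *[OF A(1,3,2)] *[OF A(2,1,3)]
      *[OF A(2,3,1)] *[OF A(3,1,2)] *[OF A(3,2,1)]
    show False by blast
  qed
  ultimately obtain x1 x2 where A_eq: "A = {x1, x2}"
    by (rule exists_two_cover)
  then have x12: "x1 \<in> set_pmf p" "x2 \<in> set_pmf p"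
    using A_sub by simp_all
  have outside: "ov x = 0" if "x \<noteq> x1" "x \<noteq> x2" for x
  proof -
    have "x \<notin> A"
      unfolding A_eq using that by simp
    then show ?thesis
      by (simp add: A_def)
  qed
  have "(\<integral>\<^sup>+x. ennreal (ov x) \<partial>count_space UNIV) = (\<integral>\<^sup>+x. ennreal (ov x) \<partial>count_space {x1, x2})"
    by (intro nn_integral_count_space_eq) (auto simp: outside)
  also have "\<dots> = (\<Sum>x\<in>{x1, x2}. ennreal (ov x))"
    by (simp add: nn_integral_count_space_finite)
  also have "\<dots> = ennreal (\<Sum>x\<in>{x1, x2}. ov x)"
    using ov_nonneg by (intro sum_ennreal)
  finally have sum: "(\<Sum>x\<in>{x1, x2}. ov x) = pmf q z"
    using total ov_nonneg by (simp add: sum_nonneg)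
  show thesis
  proof (cases "x1 = x2")
    case True
    show thesis
    proof (rule that[of "\<lambda>_. x1"])
      show "pmf q z * measure_pmf.prob v {w. x1 = x} = measure lborel (slot q z \<inter> slot p x)" for x
        using sum True outside[of x] by (cases "x = x1") (auto simp: ov_def)
    qed (use x12 in auto)
  next
    case False
    then have sum': "ov x1 + ov x2 = pmf q z"
      using sum by simp
    obtain S where S: "measure_pmf.prob v S = ov x1 / pmf q z"
    proof -
      have "0 \<le> ov x1 / pmf q z \<and> ov x1 / pmf q z \<le> 1"
        using sum' ov_nonneg[of x1] ov_nonneg[of x2] pos by simp
      then show thesis
        using v that unfolding bernoulli_universal_def by blast
    qed
    have S': "measure_pmf.prob v (- S) = ov x2 / pmf q z"
      using measure_pmf.prob_compl[of S v] S sum' pos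
      by (simp add: Compl_eq_Diff_UNIV field_simps)
    show thesis
    proof (rule that[of "\<lambda>w. if w \<in> S then x1 else x2"])
      fix x
      consider "x = x1" | "x = x2" | "x \<noteq> x1" "x \<noteq> x2"
        by blast
      then show "pmf q z * measure_pmf.prob v {w. (if w \<in> S then x1 else x2) = x}
          = measure lborel (slot q z \<inter> slot p x)"
      proof cases
        case 1
        then have "{w. (if w \<in> S then x1 else x2) = x} = S" using False by auto
        with 1 S pos show ?thesis by (simp add: ov_def)
      next
        case 2
        then have "{w. (if w \<in> S then x1 else x2) = x} = - S" using False by auto
        with 2 S' pos show ?thesis by (simp add: ov_def)
      next
        case 3
        then have "{w. (if w \<in> S then x1 else x2) = x} = {}" by auto
        with outside[OF 3] show ?thesis by (simp add: ov_def)
      qed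
    qed (use x12 in auto)
  qed
qed

text \<open>Averaging the splits over \<open>z\<close> adds up the overlaps of
  \<open>slot p x\<close> with all slots of \<open>q\<close>, which gives its length
  \<open>pmf p x\<close>.\<close>

lemma exists_function_of_dominating:
  assumes v: "bernoulli_universal v" and dom: "info_spectrum_cdf q \<le> info_spectrum_cdf p"
  obtains f where "map_pmf f (pair_pmf q v) = p"
proof -
  have "\<forall>z. \<exists>h. z \<in> set_pmf q \<longrightarrow> (\<forall>x. pmf q z * measure_pmf.prob v {w. h w = x}
      = measure lborel (slot q z \<inter> slot p x))"
    using exists_split[OF v dom] by metis
  then obtain h where h: "\<And>z x. z \<in> set_pmf q \<Longrightarrow>
      pmf q z * measure_pmf.prob v {w. h z w = x} = measure lborel (slot q z \<inter> slot p x)"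
    by metis
  have "map_pmf (\<lambda>(z, w). h z w) (pair_pmf q v) = p"
  proof (rule pmf_eqI)
    fix x
    have "ennreal (pmf (map_pmf (\<lambda>(z, w). h z w) (pair_pmf q v)) x)
        = ennreal (pmf (bind_pmf q (\<lambda>z. map_pmf (h z) v)) x)"
      by (simp add: pair_pmf_def map_pmf_def bind_assoc_pmf bind_return_pmf)
    also have "\<dots> = (\<integral>\<^sup>+z. ennreal (pmf q z) * ennreal (pmf (map_pmf (h z) v) x) \<partial>count_space UNIV)"
      by (simp add: ennreal_pmf_bind nn_integral_measure_pmf)
    also have "\<dots> = (\<integral>\<^sup>+z. emeasure lborel (slot p x \<inter> slot q z) \<partial>count_space UNIV)"
    proof (rule nn_integral_cong)
      fix z
      show "ennreal (pmf q z) * ennreal (pmf (map_pmf (h z) v) x) = emeasure lborel (slot p x \<inter> slot q z)"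
      proof (cases "z \<in> set_pmf q")
        case True
        have "emeasure lborel (slot p x \<inter> slot q z) \<le> emeasure lborel (slot p x)"
          by (intro emeasure_mono) auto
        then have "emeasure lborel (slot p x \<inter> slot q z) < \<infinity>"
          by (auto simp: emeasure_slot intro: le_less_trans)
        then have "emeasure lborel (slot p x \<inter> slot q z) = ennreal (measure lborel (slot q z \<inter> slot p x))"
          by (simp add: emeasure_eq_ennreal_measure Int_commute)
        then show ?thesis
          using h[OF True, of x] by (simp add: ennreal_mult[symmetric] pmf_map vimage_def)
      qed (simp add: slot_empty set_pmf_iff)
    qed
    also have "\<dots> = ennreal (pmf p x)"
      using nn_integral_slots[of "slot p x" q] slot_subset[of p x] by (simp add: emeasure_slot)
    finally show "pmf (map_pmf (\<lambda>(z, w). h z w) (pair_pmf q v)) x = pmf p x"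
      by simp
  qed
  then show thesis by (rule that)
qed

section \<open>Coins from i.i.d. copies\<close>

text \<open>
  The auxiliary variable is 0 with probability \<open>s\<close> and otherwise geometric.  The ratio \<open>2/5\<close> is
  smaller than the ratio \<open>1/2\<close> needed for a single geometric variable to simulate every coin; the
  position of the first nonzero entry among \<open>n \<ge> 2\<close> copies makes up for it.  The entropy saved in
  this way absorbs the gap between an infimum and its approximations, and makes the constant
  \<open>2.43\<close> work for \<open>n = 2\<close>.
\<close>

definition coin_pmf :: "real \<Rightarrow> nat pmf" where
  "coin_pmf s = bind_pmf (bernoulli_pmf s)
     (\<lambda>b. if b then return_pmf 0 else map_pmf Suc (geometric_pmf (3 / 5)))"

lemma pmf_coin_pmf:
  assumes "0 \<le> s" "s \<le> 1"
  shows "pmf (coin_pmf s) 0 = s"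
    "pmf (coin_pmf s) (Suc k) = (1 - s) * ((2 / 5) ^ k * (3 / 5))"
proof -
  have "pmf (map_pmf Suc (geometric_pmf (3 / 5))) 0 = 0"
    by (auto simp: pmf_eq_0_set_pmf)
  then show "pmf (coin_pmf s) 0 = s"
    using assms by (simp add: coin_pmf_def pmf_bind integral_measure_pmf_real[of UNIV] UNIV_bool)
  have "pmf (map_pmf Suc (geometric_pmf (3 / 5))) (Suc k) = (2 / 5) ^ k * (3 / 5)"
    by (subst pmf_map_inj') (auto simp: field_simps)
  then show "pmf (coin_pmf s) (Suc k) = (1 - s) * ((2 / 5) ^ k * (3 / 5))"
    using assms by (simp add: coin_pmf_def pmf_bind integral_measure_pmf_real[of UNIV] UNIV_bool)
qed

text \<open>The grouping rule: the factor of \<open>1 - s\<close> is the entropy of the geometric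
  law, whose mean is \<open>2 / 3\<close>.\<close>

lemma shannon_entropy_coin_pmf:
  assumes "0 < s" "s < 1"
  shows "shannon_entropy (coin_pmf s)
    = ennreal (binary_entropy s + (1 - s) * (log 2 (5 / 3) + 2 / 3 * log 2 (5 / 2)))"
proof -
  define A where "A = - log 2 (1 - s) + log 2 (5 / 3)"
  define B :: real where "B = log 2 (5 / 2)"
  let ?f = "\<lambda>k. - pmf (coin_pmf s) k * log 2 (pmf (coin_pmf s) k)"
  have f0: "?f 0 = - s * log 2 s"
    using assms by (simp add: pmf_coin_pmf)
  have fS: "?f (Suc k) = (1 - s) * (3 / 5) * (A * (2 / 5) ^ k + B * ((2 / 5) ^ k * real k))" for k
  proof -
    have "log 2 ((1 - s) * ((2 / 5) ^ k * (3 / 5))) = log 2 (1 - s) + (k * log 2 (2 / 5) + log 2 (3 / 5))"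
      using assms by (subst log_mult_pos, simp, simp, subst log_mult_pos) (simp_all add: log_nat_power)
    also have "\<dots> = - A - k * B"
      by (simp add: A_def B_def log_divide algebra_simps)
    finally have "log 2 ((1 - s) * ((2 / 5) ^ k * (3 / 5))) = - A - k * B" .
    then show ?thesis
      using assms by (simp only: pmf_coin_pmf less_imp_le) (simp add: field_simps)
  qed
  have "(\<lambda>k. (2 / 5 :: real) ^ k) sums (1 / (1 - 2 / 5))"
    by (rule geometric_sums) simp
  moreover have "(\<lambda>k. (2 / 5 :: real) ^ k * real k) sums ((2 / 5) / (1 - 2 / 5)\<^sup>2)"
    by (rule geometric_sums_times_n) simp
  ultimately have "(\<lambda>k. (1 - s) * (3 / 5) * (A * (2 / 5) ^ k + B * ((2 / 5) ^ k * real k)))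
      sums ((1 - s) * (3 / 5) * (A * (1 / (1 - 2 / 5)) + B * ((2 / 5) / (1 - 2 / 5)\<^sup>2)))"
    by (intro sums_mult sums_add)
  moreover have "(1 - s) * (3 / 5) * (A * (1 / (1 - 2 / 5)) + B * ((2 / 5) / (1 - 2 / 5)\<^sup>2))
      = (1 - s) * (A + 2 / 3 * B)"
    by (simp add: power2_eq_square field_simps)
  ultimately have "(\<lambda>k. ?f (Suc k)) sums ((1 - s) * (A + 2 / 3 * B))"
    by (simp only: fS)
  then have "?f sums ((1 - s) * (A + 2 / 3 * B) + ?f 0)"
    by (rule sums_Suc)
  moreover have "0 \<le> ?f k" for k
    by (intro neg_mult_log_nonneg) (auto simp: pmf_le_1)
  ultimately have "shannon_entropy (coin_pmf s) = ennreal ((1 - s) * (A + 2 / 3 * B) + ?f 0)"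
    unfolding shannon_entropy_def nn_integral_count_space_nat by (intro suminf_ennreal_eq)
  also have "(1 - s) * (A + 2 / 3 * B) + ?f 0
      = binary_entropy s + (1 - s) * (log 2 (5 / 3) + 2 / 3 * log 2 (5 / 2))"
    unfolding f0 by (simp add: A_def B_def binary_entropy_def algebra_simps)
  finally show ?thesis .
qed

text \<open>The digits \<open>3 / 5 * (1 - s ^ J)\<close> rise from 0 to \<open>3 / 10\<close> in
  steps of at most \<open>3 / 5 * (1 / 3) = 1 / 5\<close>, which is where
  \<open>2 / 3 \<le> s\<close> enters. Windows of length \<open>1 / 5\<close> above them therefore
  cover the interval from 0 to \<open>1 / 2\<close>.\<close>

lemma exists_digit:
  fixes s :: real
  assumes s: "2 / 3 \<le> s" "s < 1" "s ^ n = 1 / 2" and y: "0 \<le> y" "y \<le> 1 / 2"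
  obtains J where "J \<le> n" "3 / 5 * (1 - s ^ J) \<le> y" "y \<le> 3 / 5 * (1 - s ^ J) + 1 / 5"
proof -
  define P where "P = {J. J \<le> n \<and> 3 / 5 * (1 - s ^ J) \<le> y}"
  have fin: "finite P" by (simp add: P_def)
  have "0 \<in> P" using y by (simp add: P_def)
  then have J: "Max P \<in> P"
    using fin by (intro Max_in) auto
  define J where "J = Max P"
  have JP: "J \<le> n" "3 / 5 * (1 - s ^ J) \<le> y"
    using J by (auto simp: P_def J_def)
  have "y \<le> 3 / 5 * (1 - s ^ J) + 1 / 5"
  proof (cases "J = n")
    case True
    then show ?thesis unfolding True s(3) using y by simp
  next
    case False
    have "Suc J \<notin> P"
      using Max_ge[OF fin, of "Suc J"] by (auto simp: J_def)
    then have "y < 3 / 5 * (1 - s ^ Suc J)"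
      using False JP by (simp add: P_def)
    moreover have "s ^ J * (1 - s) \<le> 1 * (1 / 3)"
      using s by (intro mult_mono power_le_one) auto
    ultimately show ?thesis
      by (simp add: field_simps)
  qed
  then show thesis using that JP by blast
qed

text \<open>An expansion of \<open>x\<close> in base \<open>5 / 2\<close>, with \<open>y k\<close>
  the rescaled remainder: the window \<open>1 / 5\<close> times \<open>5 / 2\<close> is
  \<open>1 / 2\<close>, so the remainder never leaves the range of
  \<open>exists_digit\<close>.\<close>

lemma exists_digits:
  fixes s :: real
  assumes s: "2 / 3 \<le> s" "s < 1" "s ^ n = 1 / 2" and x: "0 \<le> x" "x \<le> 1 / 2"
  obtains J where "\<And>k. J k \<le> n" "(\<lambda>k. (1 - s ^ J k) * ((2 / 5) ^ k * (3 / 5))) sums x"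
proof -
  have "\<forall>y. \<exists>J. 0 \<le> y \<and> y \<le> 1 / 2 \<longrightarrow> J \<le> n \<and> 3 / 5 * (1 - s ^ J) \<le> y \<and> y \<le> 3 / 5 * (1 - s ^ J) + 1 / 5"
    using exists_digit[OF s] by metis
  then obtain d where d: "\<And>y. 0 \<le> y \<Longrightarrow> y \<le> 1 / 2 \<Longrightarrow>
      d y \<le> n \<and> 3 / 5 * (1 - s ^ d y) \<le> y \<and> y \<le> 3 / 5 * (1 - s ^ d y) + 1 / 5"
    by metis
  define y where "y = rec_nat x (\<lambda>_ z. 5 / 2 * (z - 3 / 5 * (1 - s ^ d z)))"
  have y_simps: "y 0 = x" "y (Suc k) = 5 / 2 * (y k - 3 / 5 * (1 - s ^ d (y k)))" for k
    by (simp_all add: y_def)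
  have y: "0 \<le> y k \<and> y k \<le> 1 / 2" for k
  proof (induction k)
    case (Suc k)
    then have "0 \<le> y k" "y k \<le> 1 / 2"
      by auto
    note d' = d[OF this]
    define e where "e = 3 / 5 * (1 - s ^ d (y k))"
    have "e \<le> y k" "y k \<le> e + 1 / 5" "y (Suc k) = 5 / 2 * (y k - e)"
      using d' by (auto simp: e_def y_simps)
    then show ?case by (simp add: field_simps)
  qed (use x in \<open>simp add: y_simps\<close>)
  define J where "J k = d (y k)" for k
  have partial: "(\<Sum>i<k. (1 - s ^ J i) * ((2 / 5) ^ i * (3 / 5))) = x - (2 / 5) ^ k * y k" for k
    by (induction k) (simp_all add: y_simps J_def algebra_simps)
  have "(\<lambda>k. (2 / 5) ^ k * y k) \<longlonglongrightarrow> 0"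
  proof (rule tendsto_sandwich[of "\<lambda>_. 0" _ _ "\<lambda>k. (2 / 5) ^ k"])
    show "\<forall>\<^sub>F k in sequentially. (2 / 5) ^ k * y k \<le> (2 / 5) ^ k"
      using y by (intro always_eventually allI) (simp add: mult_left_le order_trans[of _ "1 / 2"])
    show "(\<lambda>k. (2 / 5 :: real) ^ k) \<longlonglongrightarrow> 0"
      by (intro LIMSEQ_realpow_zero) auto
  qed (use y in \<open>auto intro!: always_eventually\<close>)
  then have "(\<lambda>k. x - (2 / 5) ^ k * y k) \<longlonglongrightarrow> x - 0"
    by (intro tendsto_diff tendsto_const)
  then have "(\<lambda>k. (1 - s ^ J k) * ((2 / 5) ^ k * (3 / 5))) sums x"
    unfolding sums_def partial by simp
  moreover have "J k \<le> n" for k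
    using d[of "y k"] y by (simp add: J_def)
  ultimately show thesis using that by blast
qed

text \<open>The all-zero vectors \<open>Z\<close> have probability \<open>s ^ n = 1 / 2\<close>, so
  it remains to reach every \<open>x\<close> up to \<open>1 / 2\<close> outside \<open>Z\<close>. In
  \<open>E j k\<close> the first nonzero entry is \<open>k + 1\<close>, at position
  \<open>j + 1\<close>; letting \<open>j\<close> run below \<open>J k\<close> sums a geometric
  progression to the \<open>k\<close>-th term of the expansion of \<open>x\<close>.\<close>

lemma bernoulli_universal_coin_power:
  assumes s: "2 / 3 \<le> s" "s < 1" "s ^ n = 1 / 2"
  shows "bernoulli_universal (Pi_pmf {1..n} 0 (\<lambda>_. coin_pmf s))"
  unfolding bernoulli_universal_def
proof (intro allI impI)
  fix a :: real assume a: "0 \<le> a \<and> a \<le> 1"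
  let ?V = "Pi_pmf {1..n} 0 (\<lambda>_. coin_pmf s)"
  have s01: "0 \<le> s" "s \<le> 1"
    using s by auto
  define x where "x = (if a \<le> 1 / 2 then a else a - 1 / 2)"
  have "0 \<le> x" "x \<le> 1 / 2"
    using a by (auto simp: x_def)
  then obtain J where J: "\<And>k. J k \<le> n" "(\<lambda>k. (1 - s ^ J k) * ((2 / 5) ^ k * (3 / 5))) sums x"
    by (rule exists_digits[OF s]) blast
  define Z :: "(nat \<Rightarrow> nat) set" where "Z = {\<omega>. \<forall>i\<in>{1..n}. \<omega> i = 0}"
  define E where "E j k = {\<omega> :: nat \<Rightarrow> nat. (\<forall>i\<in>{1..j}. \<omega> i = 0) \<and> \<omega> (Suc j) = Suc k}" for j k
  define T where "T k = (\<Union>j<J k. E j k)" for k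
  have Z: "measure_pmf.prob ?V Z = 1 / 2"
  proof -
    have "Z = Pi {1..n} (\<lambda>_. {0})"
      by (auto simp: Z_def Pi_def)
    then show ?thesis
      using s s01 by (simp add: measure_Pi_pmf_Pi measure_pmf_single pmf_coin_pmf)
  qed
  have E: "measure_pmf.prob ?V (E j k) = s ^ j * (1 - s) * ((2 / 5) ^ k * (3 / 5))" if "j < n" for j k
  proof -
    define c where "c = (1 - s) * ((2 / 5) ^ k * (3 / 5))"
    let ?B = "\<lambda>i. if i \<le> j then {0} else if i = Suc j then {Suc k} else UNIV"
    have "E j k = Pi {1..n} ?B"
      using that by (auto simp: E_def Pi_def split: if_splits)
    then have "measure_pmf.prob ?V (E j k) = (\<Prod>i\<in>{1..n}. measure_pmf.prob (coin_pmf s) (?B i))"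
      by (simp add: measure_Pi_pmf_Pi)
    also have "\<dots> = (\<Prod>i\<in>{1..n}. if i \<le> j then s else if i = Suc j then c else 1)"
      by (intro prod.cong) (auto simp: measure_pmf_single pmf_coin_pmf s01 c_def)
    also have "(\<Prod>i\<in>{1..m}. if i \<le> j then s else if i = Suc j then c else 1)
        = (if m \<le> j then s ^ m else s ^ j * c)" for m
      by (induction m) auto
    finally show ?thesis
      using that by (simp add: c_def mult.assoc)
  qed
  have E_disj: "E j k \<inter> E j' k' = {}" if "j < j' \<or> j = j' \<and> k \<noteq> k'" for j j' k k'
    using that by (auto simp: E_def)
  have T: "measure_pmf.prob ?V (T k) = (1 - s ^ J k) * ((2 / 5) ^ k * (3 / 5))" for k
  proof -
    have "measure_pmf.prob ?V (T k) = (\<Sum>j<J k. measure_pmf.prob ?V (E j k))"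
      unfolding T_def
    proof (intro measure_pmf.finite_measure_finite_Union)
      show "disjoint_family_on (\<lambda>j. E j k) {..<J k}"
        unfolding disjoint_family_on_def using E_disj by (metis Int_commute linorder_neqE_nat)
    qed auto
    also have "\<dots> = (\<Sum>j<J k. s ^ j) * (1 - s) * ((2 / 5) ^ k * (3 / 5))"
      unfolding sum_distrib_right using J(1)[of k] by (intro sum.cong refl E) auto
    also have "(\<Sum>j<J k. s ^ j) * (1 - s) = 1 - s ^ J k"
      using one_diff_power_eq[of s "J k"] by (simp add: mult.commute)
    finally show ?thesis .
  qed
  have "(\<lambda>k. measure_pmf.prob ?V (T k)) sums measure_pmf.prob ?V (\<Union>k. T k)"
  proof (intro measure_pmf.finite_measure_UNION)
    show "disjoint_family T"
      unfolding disjoint_family_on_def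
    proof (intro ballI impI)
      fix k k' :: nat assume "k \<noteq> k'"
      then have "E j k \<inter> E j' k' = {}" for j j'
        using E_disj[of j j' k k'] E_disj[of j' j k' k] by (cases j j' rule: linorder_cases) auto
      then show "T k \<inter> T k' = {}"
        by (auto simp: T_def)
    qed
  qed auto
  from this[unfolded T] J(2) have UT: "measure_pmf.prob ?V (\<Union>k. T k) = x"
    by (rule sums_unique2)
  show "\<exists>S. measure_pmf.prob ?V S = a"
  proof (cases "a \<le> 1 / 2")
    case True
    then show ?thesis using UT by (auto simp: x_def)
  next
    case False
    have "Z \<inter> (\<Union>k. T k) = {}"
    proof -
      have "\<omega> \<notin> E j k" if "\<omega> \<in> Z" "j < J k" for \<omega> j k
        using that J(1)[of k] by (auto simp: Z_def E_def)
      then show ?thesis by (auto simp: T_def)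
    qed
    then have "measure_pmf.prob ?V (Z \<union> (\<Union>k. T k))
        = measure_pmf.prob ?V Z + measure_pmf.prob ?V (\<Union>k. T k)"
      by (intro measure_pmf.finite_measure_Union) auto
    then have "measure_pmf.prob ?V (Z \<union> (\<Union>k. T k)) = 1 / 2 + x"
      unfolding Z UT .
    then show ?thesis using False by (auto simp: x_def)
  qed
qed

section \<open>The law of the self-information\<close>

definition info_law :: "'a pmf \<Rightarrow> real measure" where
  "info_law p = distr (measure_pmf p) borel (self_info p)"

lemma self_info_nonneg: "0 \<le> self_info p x"
proof (cases "pmf p x = 0")
  case False
  then show ?thesis by (simp add: self_info_def pmf_le_1 pmf_pos)
qed (simp add: self_info_def log_def)

lemma nonneg_law_info_law: "nonneg_law (info_law p)"
  unfolding nonneg_law_def info_law_def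
  by (auto simp: AE_distr_iff self_info_nonneg 
      intro!: prob_space.real_distribution_distr measure_pmf.prob_space_axioms)

lemmas real_distribution_info_law = nonneg_lawD[OF nonneg_law_info_law]

lemma cdf_info_law: "cdf (info_law p) = info_spectrum_cdf p"
  by (auto simp: cdf_def info_law_def info_spectrum_cdf_def measure_distr vimage_def fun_eq_iff)

lemma law_mean_info_law: "law_mean (info_law p) = shannon_entropy p"
proof -
  have "law_mean (info_law p) = (\<integral>\<^sup>+x. ennreal (self_info p x) \<partial>measure_pmf p)"
    unfolding law_mean_def info_law_def by (subst nn_integral_distr) auto
  also have "\<dots> = shannon_entropy p"
    unfolding nn_integral_measure_pmf shannon_entropy_def
    by (intro nn_integral_cong) (simp add: self_info_def ennreal_mult'[symmetric])
  finally show ?thesis .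
qed

lemma cdf_mean_info_spectrum_cdf: "cdf_mean (info_spectrum_cdf p) = shannon_entropy p"
  by (simp add: cdf_info_law[symmetric] cdf_mean_cdf real_distribution_info_law law_mean_info_law)

lemma info_law_map_inj:
  assumes "inj_on f (set_pmf p)"
  shows "info_law (map_pmf f p) = info_law p"
proof -
  have "info_law (map_pmf f p) = distr (measure_pmf p) borel (\<lambda>x. self_info (map_pmf f p) (f x))"
    unfolding info_law_def map_pmf_rep_eq by (subst distr_distr) (auto simp: o_def)
  also have "\<dots> = info_law p"
    unfolding info_law_def
    by (intro distr_cong_AE) (auto simp: AE_measure_pmf_iff self_info_def pmf_map_inj[OF assms])
  finally show ?thesis .
qed

lemma info_law_return: "info_law (return_pmf c) = return borel 0"
proof -
  have "info_law (return_pmf c) = distr (measure_pmf (return_pmf c)) borel (\<lambda>_. 0)"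
    unfolding info_law_def
    by (intro distr_cong_AE) (auto simp: AE_measure_pmf_iff self_info_def)
  then show ?thesis
    by (simp add: measure_pmf.distr_const)
qed

text \<open>Self-information is additive over independent pairs of positive mass. As
  \<open>log 2 0 = 0\<close> breaks this elsewhere, the cdfs are compared under the integral, almost
  surely.\<close>

lemma info_law_pair: "info_law (pair_pmf p q) = (info_law p \<star> info_law q)"
proof (rule cdf_unique)
  show "cdf (info_law (pair_pmf p q)) = cdf (info_law p \<star> info_law q)"
  proof
    fix t
    have "ennreal (cdf (info_law p \<star> info_law q) t)
        = (\<integral>\<^sup>+x. ennreal (info_spectrum_cdf q (t - x)) \<partial>info_law p)"
      by (simp add: cdf_convolution real_distribution_info_law cdf_info_law)
    also have "\<dots> = (\<integral>\<^sup>+x. ennreal (info_spectrum_cdf q (t - self_info p x)) \<partial>measure_pmf p)"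
    proof -
      have "cdf (info_law q) \<in> borel_measurable borel"
        using finite_borel_measure.cdf_nondecreasing[OF real_distribution.finite_borel_measure_M[OF
            real_distribution_info_law]] by (intro borel_measurable_mono monoI)
      then have [measurable]: "info_spectrum_cdf q \<in> borel_measurable borel"
        by (simp add: cdf_info_law)
      show ?thesis
        unfolding info_law_def by (subst nn_integral_distr) auto
    qed
    also have "\<dots> = (\<integral>\<^sup>+x. (\<integral>\<^sup>+y. indicator {y. self_info q y \<le> t - self_info p x} y \<partial>measure_pmf q) \<partial>measure_pmf p)"
      by (simp add: info_spectrum_cdf_def measure_pmf.emeasure_eq_measure)
    also have "\<dots> = (\<integral>\<^sup>+x. (\<integral>\<^sup>+y. indicator {z. self_info (pair_pmf p q) z \<le> t} (x, y) \<partial>measure_pmf q) \<partial>measure_pmf p)"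
    proof (intro nn_integral_cong_AE AE_pmfI)
      fix x y assume "x \<in> set_pmf p" "y \<in> set_pmf q"
      then have "self_info (pair_pmf p q) (x, y) = self_info p x + self_info q y"
        by (simp add: self_info_def pmf_pair log_mult_pos pmf_positive)
      then show "indicator {y. self_info q y \<le> t - self_info p x} y
          = (indicator {z. self_info (pair_pmf p q) z \<le> t} (x, y) :: ennreal)"
        by (auto simp: indicator_def)
    qed
    also have "\<dots> = (\<integral>\<^sup>+z. indicator {z. self_info (pair_pmf p q) z \<le> t} z \<partial>measure_pmf (pair_pmf p q))"
      by (simp only: nn_integral_pair_pmf')
    also have "\<dots> = ennreal (cdf (info_law (pair_pmf p q)) t)"
      by (simp add: cdf_info_law info_spectrum_cdf_def measure_pmf.emeasure_eq_measure)
    finally show "cdf (info_law (pair_pmf p q)) t = cdf (info_law p \<star> info_law q) t"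
      by (simp add: cdf_def)
  qed
qed (intro real_distribution_convolution real_distribution_info_law)+

lemma info_law_Pi_pmf:
  assumes "finite A"
  shows "info_law (Pi_pmf A d (\<lambda>_. p)) = conv_power (info_law p) (card A)"
  using assms
proof (induction A)
  case empty
  then show ?case by (simp add: info_law_return)
next
  case (insert x A)
  \<comment> \<open>The value of \<open>f\<close> at \<open>x\<close> is lost in the update, but on
    the support it is the default \<open>d\<close>.\<close>
  have "inj_on (\<lambda>(y, f). f(x := y)) (set_pmf (pair_pmf p (Pi_pmf A d (\<lambda>_. p))))"
  proof (rule inj_onI, clarify)
    fix y f y' f'
    assume "(y, f) \<in> set_pmf (pair_pmf p (Pi_pmf A d (\<lambda>_. p)))"
      "(y', f') \<in> set_pmf (pair_pmf p (Pi_pmf A d (\<lambda>_. p)))" "f(x := y) = f'(x := y')"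
    then have fx: "f x = d" "f' x = d" and eq: "f(x := y) = f'(x := y')"
      using set_Pi_pmf_subset[OF insert.hyps(1), of d "\<lambda>_. p"] insert.hyps(2) by auto
    from eq have "y = y'" by (metis fun_upd_same)
    moreover have "f = f'"
      using eq fx by (metis fun_upd_triv fun_upd_upd)
    ultimately show "y = y' \<and> f = f'" by simp
  qed
  then show ?case
    using insert by (simp add: Pi_pmf_insert info_law_map_inj info_law_pair)
qed

section \<open>Entropy of pairs and realisation by i.i.d. copies\<close>

lemma shannon_entropy_pair: "shannon_entropy (pair_pmf p q) = shannon_entropy p + shannon_entropy q"
  by (simp add: law_mean_info_law[symmetric] info_law_pair law_mean_convolution nonneg_law_info_law)

lemma shannon_entropy_map_inj:
  "inj_on f (set_pmf p) \<Longrightarrow> shannon_entropy (map_pmf f p) = shannon_entropy p"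
  by (simp add: law_mean_info_law[symmetric] info_law_map_inj)

text \<open>Encoding commutes with taking copies because \<open>prod_encode (0, 0) = 0\<close>, so
  the defaults outside \<open>A\<close> agree as well.\<close>

lemma Pi_pmf_pair_encode:
  assumes A: "finite A"
  shows "Pi_pmf A 0 (\<lambda>_. map_pmf prod_encode (pair_pmf W V))
    = map_pmf (\<lambda>(w, v) i. prod_encode (w i, v i)) (pair_pmf (Pi_pmf A 0 (\<lambda>_. W)) (Pi_pmf A 0 (\<lambda>_. V)))"
    (is "?L = map_pmf ?zip ?P")
proof (rule pmf_eqI)
  fix \<phi> :: "'a \<Rightarrow> nat"
  define w where "w i = fst (prod_decode (\<phi> i))" for i
  define v where "v i = snd (prod_decode (\<phi> i))" for i
  have \<phi>: "\<phi> = ?zip (w, v)"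
    by (simp add: w_def v_def)
  have "inj ?zip"
    by (rule injI) (auto simp: fun_eq_iff)
  then have "pmf (map_pmf ?zip ?P) \<phi> = pmf (Pi_pmf A 0 (\<lambda>_. W)) w * pmf (Pi_pmf A 0 (\<lambda>_. V)) v"
    unfolding \<phi> by (subst pmf_map_inj') (auto simp: pmf_pair)
  moreover have "pmf (map_pmf prod_encode (pair_pmf W V)) (\<phi> i) = pmf W (w i) * pmf V (v i)" for i
    unfolding \<phi> by (simp add: pmf_map_inj' inj_prod_encode pmf_pair)
  moreover have "\<phi> i = 0 \<longleftrightarrow> w i = 0 \<and> v i = 0" for i
  proof -
    have "\<phi> i = prod_encode (0, 0) \<longleftrightarrow> w i = 0 \<and> v i = 0"
      unfolding \<phi> by simp
    then show ?thesis by (simp add: prod_encode_def)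
  qed
  ultimately show "pmf ?L \<phi> = pmf (map_pmf ?zip ?P) \<phi>"
    using A by (auto simp: pmf_Pi prod.distrib)
qed

text \<open>The copies are the coordinates of the product. The restricted function given to
  \<open>f\<close> is undefined outside \<open>{1..n}\<close>, so \<open>f\<close> restores the
  default 0 there before applying \<open>g\<close>.\<close>

lemma exists_iid_realization:
  fixes P :: "nat pmf" and n :: nat
  assumes n: "n \<ge> 1" and g: "map_pmf g (Pi_pmf {1..n} 0 (\<lambda>_. P)) = p"
  shows "\<exists>(\<Omega> :: (nat \<Rightarrow> nat) pmf) (Z :: nat \<Rightarrow> (nat \<Rightarrow> nat) \<Rightarrow> nat) f.
    prob_space.indep_vars (measure_pmf \<Omega>) (\<lambda>_. count_space UNIV) Z {1..n} \<and>
    (\<forall>i\<in>{1..n}. map_pmf (Z i) \<Omega> = map_pmf (Z 1) \<Omega>) \<and>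
    map_pmf (\<lambda>\<omega>. f (\<lambda>i\<in>{1..n}. Z i \<omega>)) \<Omega> = p \<and>
    map_pmf (Z 1) \<Omega> = P"
proof (intro exI conjI)
  let ?\<Omega> = "Pi_pmf {1..n} 0 (\<lambda>_. P)"
  let ?Z = "\<lambda>i (\<omega> :: nat \<Rightarrow> nat). \<omega> i"
  let ?f = "\<lambda>\<phi>. g (\<lambda>i. if i \<in> {1..n} then \<phi> i else 0)"
  have comp: "map_pmf (?Z i) ?\<Omega> = P" if "i \<in> {1..n}" for i
    using that by (subst Pi_pmf_component) auto
  show "prob_space.indep_vars (measure_pmf ?\<Omega>) (\<lambda>_. count_space UNIV) ?Z {1..n}"
    by (rule indep_vars_Pi_pmf) simp
  show "\<forall>i\<in>{1..n}. map_pmf (?Z i) ?\<Omega> = map_pmf (?Z 1) ?\<Omega>"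
    using comp n by simp
  show "map_pmf (?Z 1) ?\<Omega> = P"
    using comp n by simp
  have "?f (\<lambda>i\<in>{1..n}. ?Z i \<omega>) = g \<omega>" if "\<omega> \<in> set_pmf ?\<Omega>" for \<omega>
  proof -
    have "\<omega> i = 0" if "i \<notin> {1..n}" for i
      using \<open>\<omega> \<in> set_pmf ?\<Omega>\<close> set_Pi_pmf_subset[of "{1..n}" 0 "\<lambda>_. P"] that by auto
    then have "(\<lambda>i. if i \<in> {1..n} then (\<lambda>i\<in>{1..n}. ?Z i \<omega>) i else 0) = \<omega>"
      by (auto simp: fun_eq_iff)
    then show ?thesis by simp
  qed
  then have "map_pmf (\<lambda>\<omega>. ?f (\<lambda>i\<in>{1..n}. ?Z i \<omega>)) ?\<Omega> = map_pmf g ?\<Omega>"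
    by (intro map_pmf_cong) simp_all
  then show "map_pmf (\<lambda>\<omega>. ?f (\<lambda>i\<in>{1..n}. ?Z i \<omega>)) ?\<Omega> = p"
    using g by simp
qed

text \<open>The \<open>W\<close>-components of the copies supply the dominating variable, the
  \<open>V\<close>-components the coins.\<close>

lemma exists_function_of_pairs:
  fixes W V :: "nat pmf"
  assumes "bernoulli_universal (Pi_pmf {1..n} 0 (\<lambda>_. V))"
    and "cdf (conv_power (info_law W) n) \<le> info_spectrum_cdf p"
  obtains g where "map_pmf g (Pi_pmf {1..n} 0 (\<lambda>_. map_pmf prod_encode (pair_pmf W V))) = p"
proof -
  have "info_spectrum_cdf (Pi_pmf {1..n} 0 (\<lambda>_. W)) \<le> info_spectrum_cdf p"
    using assms(2) by (simp add: cdf_info_law[symmetric] info_law_Pi_pmf)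
  then obtain f where f: "map_pmf f (pair_pmf (Pi_pmf {1..n} 0 (\<lambda>_. W)) (Pi_pmf {1..n} 0 (\<lambda>_. V))) = p"
    using exists_function_of_dominating[OF assms(1)] by blast
  let ?unzip = "\<lambda>\<phi>. (\<lambda>i. fst (prod_decode (\<phi> i)), \<lambda>i. snd (prod_decode (\<phi> i)))"
  have "map_pmf (f \<circ> ?unzip) (Pi_pmf {1..n} 0 (\<lambda>_. map_pmf prod_encode (pair_pmf W V))) = p"
    unfolding f[symmetric]
    by (subst Pi_pmf_pair_encode) (auto simp: pmf.map_comp o_def case_prod_beta intro!: map_pmf_cong)
  then show thesis by (rule that)
qed

section \<open>The gap\<close>

lemma log_bounds:
  "log 2 (5 / 3) + 2 / 3 * log 2 (5 / 2) \<le> 59 / 36" "log 2 (4 / 3) \<le> 5 / 12"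
proof -
  have "log 2 x \<le> a / b" if "x ^ b \<le> 2 ^ a" "0 < x" "0 < b" for x :: real and a b :: nat
  proof -
    have "real b * log 2 x = log 2 (x ^ b)"
      using that by (simp add: log_nat_power)
    also have "\<dots> \<le> log 2 (2 ^ a)"
      using that by (subst log_le_cancel_iff) auto
    also have "\<dots> = a"
      by (simp add: log_nat_power)
    finally show ?thesis
      using that by (simp add: field_simps)
  qed
  \<comment> \<open>The instances are \<open>(5 / 3) ^ 4 \<le> 2 ^ 3\<close>,
    \<open>(5 / 2) ^ 3 \<le> 2 ^ 4\<close> and \<open>(4 / 3) ^ 12 \<le> 2 ^ 5\<close>; moreover
    \<open>3 / 4 + 2 / 3 * (4 / 3) = 59 / 36\<close>.\<close>
  from this[of "5 / 3" 4 3] this[of "5 / 2" 3 4] this[of "4 / 3" 12 5]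
  show "log 2 (5 / 3) + 2 / 3 * log 2 (5 / 2) \<le> 59 / 36" "log 2 (4 / 3) \<le> 5 / 12"
    by (simp_all add: power_divide)
qed

text \<open>The exponent grows with \<open>n\<close>, so the smallest \<open>s\<close> occurs at
  \<open>n = 2\<close>, where it is \<open>1 / sqrt 2\<close>.\<close>

lemma root_half_bounds:
  assumes "n \<ge> 2"
  defines "s \<equiv> 2 powr (- 1 / real n)"
  shows "707 / 1000 \<le> s" "s < 1" "s ^ n = 1 / 2"
proof -
  have "s ^ n = s powr real n"
    using assms by (simp add: powr_realpow)
  also have "\<dots> = 2 powr (- 1 / real n * real n)"
    by (simp only: s_def powr_powr)
  also have "- 1 / real n * real n = - 1"
    using assms by simp
  also have "2 powr (- 1) = (1 / 2 :: real)"
    by (simp add: powr_minus_divide)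
  finally show "s ^ n = 1 / 2" .
  show "s < 1"
    using assms powr_less_mono[of "- 1 / real n" 0 2] by (simp add: s_def)
  have "707 / 1000 \<le> sqrt (1 / 2)"
    by (intro real_le_rsqrt) (simp add: power2_eq_square)
  also have "\<dots> = 2 powr (- 1 / 2)"
    by (simp add: powr_minus_divide powr_half_sqrt real_sqrt_divide)
  also have "\<dots> \<le> s"
    unfolding s_def using assms by (intro powr_mono) (auto simp: field_simps)
  finally show "707 / 1000 \<le> s" .
qed

text \<open>Comparison with the law \<open>(3 / 4, 1 / 4)\<close> in Gibbs' inequality bounds the
  left side by a decreasing affine function of \<open>s\<close>, which is about \<open>1.361\<close>
  at \<open>s = 707 / 1000\<close>.\<close>

lemma coin_entropy_bound:
  assumes "707 / 1000 \<le> s" "s < 1"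
  shows "binary_entropy s + (1 - s) * (log 2 (5 / 3) + 2 / 3 * log 2 (5 / 2)) \<le> 137 / 100"
proof -
  have "binary_entropy s \<le> - s * log 2 (3 / 4) - (1 - s) * log 2 (1 - 3 / 4)"
    using assms by (intro gibbs_binary) auto
  also have "\<dots> = s * log 2 (4 / 3) + (1 - s) * 2"
  proof -
    have "log 2 (3 / 4 :: real) = - log 2 (4 / 3)" "log 2 (1 / 4 :: real) = - 2"
      using log_nat_power[of 2 2 2] by (simp_all add: log_divide)
    then show ?thesis by simp
  qed
  also have "s * log 2 (4 / 3) \<le> s * (5 / 12)"
    using assms log_bounds by (intro mult_left_mono) auto
  finally have "binary_entropy s \<le> s * (5 / 12) + (1 - s) * 2" by simp
  moreover have "(1 - s) * (log 2 (5 / 3) + 2 / 3 * log 2 (5 / 2)) \<le> (1 - s) * (59 / 36)"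
    using assms log_bounds by (intro mult_left_mono) auto
  ultimately show ?thesis
    using assms by (simp add: field_simps)
qed

section \<open>Laws whose convolution power dominates the information spectrum\<close>

lemma divisible_cdf_law:
  assumes "G \<in> inf_divisible_cdfs" "n \<ge> 1"
  obtains M where "nonneg_law M" "G = cdf (conv_power M n)"
    "cdf_mean G = of_nat n * law_mean M"
proof -
  have "G \<in> divisible_cdfs n"
    using assms by (auto simp: inf_divisible_cdfs_def)
  then obtain M where M: "nonneg_law M" "G = cdf_conv_power (cdf M) n"
    by (auto simp: divisible_cdfs_def nonneg_cdfs_eq)
  then have G: "G = cdf (conv_power M n)"
    by (simp add: cdf_conv_power_cdf nonneg_lawD)
  then have "cdf_mean G = of_nat n * law_mean M"
    using M by (simp add: cdf_mean_cdf real_distribution_conv_power nonneg_lawD law_mean_conv_power)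
  then show thesis using that M G by blast
qed

lemma r_ID_mult_mean:
  assumes "cdf_mean F = ennreal h" "0 < h"
  shows "r_ID F * ennreal h = (INF G \<in> {G \<in> inf_divisible_cdfs. G \<le> F}. cdf_mean G)"
  using assms by (simp add: r_ID_def ennreal_divide_times)

text \<open>Every competitor in the infimum has a cdf below the information spectrum cdf and hence a
  mean of at least \<open>h\<close>. This settles the case \<open>n = 1\<close>.\<close>

lemma mean_le_r_ID_mult:
  fixes p :: "'a pmf"
  assumes "shannon_entropy p = ennreal h" "0 \<le> h"
  shows "ennreal h \<le> r_ID (info_spectrum_cdf p) * ennreal h"
proof (cases "h = 0")
  case False
  have "ennreal h \<le> cdf_mean G" if G: "G \<in> inf_divisible_cdfs" "G \<le> info_spectrum_cdf p" for G
  proof -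
    obtain M where M: "nonneg_law M" "G = cdf (conv_power M 1)"
      using divisible_cdf_law[OF G(1), of 1] by auto
    have D: "real_distribution (conv_power M 1)"
      using M by (intro real_distribution_conv_power nonneg_lawD)
    have "law_mean (info_law p) \<le> law_mean (conv_power M 1)"
      using G(2) M by (intro law_mean_antimono D real_distribution_info_law) (simp add: cdf_info_law)
    then show ?thesis
      unfolding M(2) using D assms by (simp add: cdf_mean_cdf law_mean_info_law)
  qed
  then show ?thesis
    using assms False
    by (subst r_ID_mult_mean) (auto simp: cdf_mean_info_spectrum_cdf intro!: INF_greatest)
qed simp

text \<open>Two bounds on one mean: the one by \<open>r_ID\<close> is what the gap subtracts, the
  one by \<open>e/(e - 1)\<close> controls the loss in the discretisation. The slack
  \<open>\<epsilon>\<close> is there because the infimum may not be attained.\<close>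

lemma exists_near_optimal_law:
  fixes p :: "'a pmf"
  assumes h: "shannon_entropy p = ennreal h" "0 \<le> h" and n: "n \<ge> 1" and \<epsilon>: "0 < \<epsilon>"
  obtains M \<mu> where "nonneg_law M" "cdf (conv_power M n) \<le> info_spectrum_cdf p"
    "law_mean M = ennreal \<mu>" "0 \<le> \<mu>" "\<mu> \<le> exp 1 / (exp 1 - 1) * (h / n)"
    "ennreal (n * \<mu>) \<le> r_ID (info_spectrum_cdf p) * ennreal h + ennreal (n * \<epsilon>)"
proof -
  define c :: real where "c = exp 1 / (exp 1 - 1)"
  have c0: "0 \<le> c" by (simp add: c_def)
  let ?r = "r_ID (info_spectrum_cdf p)"
  have "\<exists>M. nonneg_law M \<and> cdf (conv_power M n) \<le> info_spectrum_cdf p \<and>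
      of_nat n * law_mean M \<le> ennreal c * ennreal h \<and>
      of_nat n * law_mean M \<le> ?r * ennreal h + ennreal (n * \<epsilon>)"
  \<comment> \<open>If the infimum is at least \<open>c * h\<close>, the root law satisfies both
    bounds. Otherwise it is finite, and some infinitely divisible \<open>G\<close> has a mean below
    both \<open>c * h\<close> and the infimum plus \<open>n * \<epsilon>\<close>.\<close>
  proof (cases "ennreal c * ennreal h \<le> ?r * ennreal h")
    case True
    obtain M where M: "nonneg_law M" "cdf (conv_power M n) \<le> cdf (info_law p)"
      "of_nat n * law_mean M \<le> ennreal c * law_mean (info_law p)"
      using exists_root_law[OF nonneg_law_info_law n] unfolding c_def by blast
    have "of_nat n * law_mean M \<le> ennreal c * ennreal h"
      using M(3) h by (simp add: law_mean_info_law)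
    moreover from this True have "of_nat n * law_mean M \<le> ?r * ennreal h"
      by (rule order_trans)
    then have "of_nat n * law_mean M \<le> ?r * ennreal h + ennreal (n * \<epsilon>)"
      by (rule order_trans) simp
    ultimately show ?thesis
      using M(1,2) unfolding cdf_info_law by blast
  next
    case False
    then have less: "?r * ennreal h < ennreal c * ennreal h"
      by simp
    then have "h \<noteq> 0" by auto
    then have h0: "0 < h" using h by simp
    let ?I = "INF G \<in> {G \<in> inf_divisible_cdfs. G \<le> info_spectrum_cdf p}. cdf_mean G"
    have I: "?r * ennreal h = ?I"
      using h h0 by (intro r_ID_mult_mean) (simp_all add: cdf_mean_info_spectrum_cdf)
    have "?I < ennreal c * ennreal h"
      using less I by simp
    moreover have "?I < ?I + ennreal (n * \<epsilon>)"
    proof -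
      have "?I < \<top>"
        using less I by (simp add: less_top order_less_le_trans ennreal_mult_less_top) 
      then show ?thesis
        using n \<epsilon> by (cases ?I) (auto simp: ennreal_plus[symmetric] ennreal_less_iff simp del: ennreal_plus)
    qed
    ultimately have "?I < min (ennreal c * ennreal h) (?I + ennreal (n * \<epsilon>))"
      by simp
    then obtain G where G: "G \<in> inf_divisible_cdfs" "G \<le> info_spectrum_cdf p"
      "cdf_mean G < min (ennreal c * ennreal h) (?I + ennreal (n * \<epsilon>))"
      unfolding INF_less_iff by blast
    obtain M where "nonneg_law M" "G = cdf (conv_power M n)" "cdf_mean G = of_nat n * law_mean M"
      using divisible_cdf_law[OF G(1) n] by blast
    then show ?thesis
      using G I by (intro exI[of _ M]) auto
  qed
  then obtain M where M: "nonneg_law M" "cdf (conv_power M n) \<le> info_spectrum_cdf p"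
      "of_nat n * law_mean M \<le> ennreal c * ennreal h"
      "of_nat n * law_mean M \<le> ?r * ennreal h + ennreal (n * \<epsilon>)"
    by blast
  have "law_mean M < \<top>"
  proof (rule ccontr)
    assume "\<not> law_mean M < \<top>"
    then have "law_mean M = \<top>"
      using top.not_eq_extremum[of "law_mean M"] by blast
    with M(3) n show False
      by (simp add: ennreal_mult_top ennreal_mult[symmetric] c0 h top_unique)
  qed
  then obtain \<mu> where \<mu>: "law_mean M = ennreal \<mu>" "0 \<le> \<mu>"
    by (cases "law_mean M") auto
  have n_mean: "of_nat n * law_mean M = ennreal (n * \<mu>)"
    using \<mu> by (simp add: ennreal_mult ennreal_of_nat_eq_real_of_nat)
  have "n * \<mu> \<le> c * h"
    using M(3) c0 h(2) unfolding n_mean by (simp add: ennreal_mult[symmetric] del: ennreal_mult')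
  then have "\<mu> \<le> c * (h / n)"
    using n by (simp add: field_simps)
  then show thesis
    using that[OF M(1,2) \<mu>] M(4) unfolding n_mean c_def by blast
qed

text \<open>For finite \<open>r\<close> this is division by \<open>n\<close>. For
  \<open>r = \<top>\<close> the mean \<open>h\<close> is positive, and the left side is minus
  infinity.\<close>

lemma gap_le:
  fixes r H :: ennreal
  assumes H: "H \<le> ennreal (\<mu> + b)" and \<mu>: "0 \<le> \<mu>" "ennreal (n * \<mu>) \<le> r * ennreal h + ennreal (n * \<epsilon>)"
    and h: "0 \<le> h" "h = 0 \<Longrightarrow> r \<noteq> \<top>" and n: "n \<ge> (1::nat)" and \<epsilon>: "0 \<le> \<epsilon>" and b: "0 \<le> b" "b + \<epsilon> \<le> B"
  shows "enn2ereal H - enn2ereal r * (enn2ereal (ennreal h) / ereal (real n)) \<le> ereal B"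
proof -
  obtain x where x: "H = ennreal x" "0 \<le> x"
    using H by (cases H) (auto simp: top_unique)
  have hn: "enn2ereal (ennreal h) / ereal (real n) = ereal (h / n)"
    using h n by (simp add: enn2ereal_ennreal)
  have x_le: "x \<le> \<mu> + b"
    using H \<mu>(1) b(1) unfolding x(1) by (subst (asm) ennreal_le_iff) auto
  show ?thesis
  proof (cases r)
    case (real r')
    have "ennreal (n * \<mu>) \<le> ennreal (r' * h + n * \<epsilon>)"
      using \<mu>(2) real h \<epsilon> by (simp add: ennreal_mult ennreal_plus)
    then have "n * \<mu> \<le> r' * h + n * \<epsilon>"
      using real h \<epsilon> by (subst (asm) ennreal_le_iff) auto
    then have "\<mu> \<le> r' * (h / n) + \<epsilon>"
      using n by (simp add: field_simps)
    then have "x - r' * (h / n) \<le> B"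
      using x_le b by linarith
    then show ?thesis
      unfolding hn using x real by (simp add: enn2ereal_ennreal)
  next
    case top
    then have "h \<noteq> 0"
      using h(2) by auto
    then have "h \<noteq> 0" "n \<noteq> 0" "0 < h / n"
      using h(1) n by simp_all
    then show ?thesis
      unfolding hn using x top by (simp add: enn2ereal_ennreal)
  qed
qed

section \<open>Combination of the estimates\<close>

theorem proposition14:
  fixes p :: "'a pmf" and n :: nat
  assumes "shannon_entropy p < \<infinity>" and "n \<ge> 1"
  shows "\<exists>(\<Omega> :: (nat \<Rightarrow> nat) pmf) (Z :: nat \<Rightarrow> (nat \<Rightarrow> nat) \<Rightarrow> nat) (f :: (nat \<Rightarrow> nat) \<Rightarrow> 'a).
    prob_space.indep_vars (measure_pmf \<Omega>) (\<lambda>_. count_space UNIV) Z {1..n} \<and>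
    (\<forall>i\<in>{1..n}. map_pmf (Z i) \<Omega> = map_pmf (Z 1) \<Omega>) \<and>
    map_pmf (\<lambda>\<omega>. f (\<lambda>i\<in>{1..n}. Z i \<omega>)) \<Omega> = p \<and>
    enn2ereal (shannon_entropy (map_pmf (Z 1) \<Omega>))
        - enn2ereal (r_ID (info_spectrum_cdf p)) * (enn2ereal (shannon_entropy p) / ereal (real n))
      \<le> ereal (min 2.43
          (binary_entropy
             (min (sqrt (exp 1 / ((exp 1 - 1) * log 2 (exp 1)) * (enn2real (shannon_entropy p) / real n)))
                  (1 / 2))
           + binary_entropy (2 powr (- 1 / real n)) + 2 * (1 - 2 powr (- 1 / real n))))"
proof -
  obtain h where h: "shannon_entropy p = ennreal h" "0 \<le> h"
    using assms by (cases "shannon_entropy p") auto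
  let ?r = "r_ID (info_spectrum_cdf p)"
  define s where "s = 2 powr (- 1 / real n)"
  define \<beta> where "\<beta> = binary_entropy
    (min (sqrt (exp 1 / ((exp 1 - 1) * log 2 (exp 1)) * (h / real n))) (1 / 2))"
  define B where "B = min 2.43 (\<beta> + binary_entropy s + 2 * (1 - s))"
  have r_top: "?r \<noteq> \<top>" if "h = 0"
    using that h by (simp add: r_ID_def cdf_mean_info_spectrum_cdf)
  have arg_nonneg: "0 \<le> exp 1 / ((exp 1 - 1) * log 2 (exp 1)) * (h / real n)"
    using h by (intro mult_nonneg_nonneg divide_nonneg_nonneg) auto
  then have \<beta>: "0 \<le> \<beta>" "\<beta> \<le> 1"
    unfolding \<beta>_def by (auto intro!: binary_entropy_nonneg binary_entropy_le_1)
  have s01: "0 < s" "s < 1"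
    using assms powr_less_mono[of "- 1 / real n" 0 2] by (auto simp: s_def)
  have "\<exists>(P :: nat pmf) g. map_pmf g (Pi_pmf {1..n} 0 (\<lambda>_. P)) = p \<and>
      enn2ereal (shannon_entropy P) - enn2ereal ?r * (enn2ereal (ennreal h) / ereal (real n)) \<le> ereal B"
  \<comment> \<open>For \<open>n = 1\<close>, \<open>s\<close> is \<open>1 / 2\<close>, below the
    \<open>2 / 3\<close> that the digit expansion requires. The pmf \<open>p\<close> itself,
    relabelled by natural numbers, has a gap of at most 0.\<close>
  proof (cases "n = 1")
    case True
    let ?e = "to_nat_on (set_pmf p)"
    have inj: "inj_on ?e (set_pmf p)"
      by (rule inj_on_to_nat_on[OF countable_set_pmf])
    have "map_pmf (\<lambda>\<omega>. from_nat_into (set_pmf p) (\<omega> 1)) (Pi_pmf {1..n} 0 (\<lambda>_. map_pmf ?e p))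
        = map_pmf (from_nat_into (set_pmf p)) (map_pmf (\<lambda>\<omega>. \<omega> 1) (Pi_pmf {1..n} 0 (\<lambda>_. map_pmf ?e p)))"
      by (simp add: pmf.map_comp o_def)
    also have "\<dots> = map_pmf (from_nat_into (set_pmf p)) (map_pmf ?e p)"
      using True by (subst Pi_pmf_component) auto
    also have "\<dots> = map_pmf (\<lambda>x. x) p"
      unfolding pmf.map_comp by (intro map_pmf_cong) auto
    finally have g: "map_pmf (\<lambda>\<omega>. from_nat_into (set_pmf p) (\<omega> 1)) (Pi_pmf {1..n} 0 (\<lambda>_. map_pmf ?e p)) = p"
      by (simp only: map_pmf_ident)
    have H: "shannon_entropy (map_pmf ?e p) = ennreal h"
      using shannon_entropy_map_inj[OF inj] h by simp
    have "0 \<le> B"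
      using \<beta> s01 binary_entropy_nonneg[of s] by (simp add: B_def)
    then have "enn2ereal (shannon_entropy (map_pmf ?e p))
        - enn2ereal ?r * (enn2ereal (ennreal h) / ereal (real n)) \<le> ereal B"
      unfolding H
      using mean_le_r_ID_mult[OF h] True h r_top
      by (intro gap_le[where \<mu> = h and b = 0 and \<epsilon> = 0]) auto
    with g show ?thesis
      by (intro exI conjI)
  next
    case False
    then have n2: "n \<ge> 2" using assms by simp
    note s = root_half_bounds[OF n2, folded s_def]
    define \<kappa> where "\<kappa> = binary_entropy s + (1 - s) * (log 2 (5 / 3) + 2 / 3 * log 2 (5 / 2))"
    \<comment> \<open>The slack is what the coins leave over:
      \<open>6 / 100 = 2.43 - 1 - 137 / 100\<close>, where 1 bounds \<open>\<beta>\<close> and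
      \<open>137 / 100\<close> bounds \<open>\<kappa>\<close>, and
      \<open>13 / 36 = 2 - 59 / 36\<close>.\<close>
    define \<epsilon> where "\<epsilon> = min (6 / 100) ((1 - s) * (13 / 36))"
    have \<epsilon>: "0 < \<epsilon>"
      using s01 by (simp add: \<epsilon>_def)
    have \<epsilon>_le: "\<epsilon> \<le> 6 / 100" "\<epsilon> \<le> (1 - s) * (13 / 36)"
      unfolding \<epsilon>_def by (intro min.cobounded1 min.cobounded2)+
    obtain M and \<mu> :: real where M: "nonneg_law M" "cdf (conv_power M n) \<le> info_spectrum_cdf p"
        "law_mean M = ennreal \<mu>" "0 \<le> \<mu>"
      and \<mu>: "\<mu> \<le> exp 1 / (exp 1 - 1) * (h / n)" "ennreal (n * \<mu>) \<le> ?r * ennreal h + ennreal (n * \<epsilon>)"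
      by (rule exists_near_optimal_law[OF h assms(2) \<epsilon>])
    obtain W :: "nat pmf" where W: "info_spectrum_cdf W \<le> cdf M"
      "shannon_entropy W \<le> ennreal (\<mu> + binary_entropy (min (sqrt (\<mu> * ln 2)) (1 / 2)))"
      by (rule exists_discretization[OF M(1,3,4)])
    let ?P = "map_pmf prod_encode (pair_pmf W (coin_pmf s))"
    have "cdf (conv_power (info_law W) n) \<le> cdf (conv_power M n)"
      using W(1) M(1) real_distribution_info_law
      by (intro cdf_conv_power_mono) (simp_all add: cdf_info_law nonneg_lawD)
    from order_trans[OF this M(2)]
    have dom: "cdf (conv_power (info_law W) n) \<le> info_spectrum_cdf p" .
    have "bernoulli_universal (Pi_pmf {1..n} 0 (\<lambda>_. coin_pmf s))"
      using s by (intro bernoulli_universal_coin_power) auto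
    from exists_function_of_pairs[OF this dom]
    obtain g where g: "map_pmf g (Pi_pmf {1..n} 0 (\<lambda>_. ?P)) = p" .
    have "enn2ereal (shannon_entropy ?P)
        - enn2ereal ?r * (enn2ereal (ennreal h) / ereal (real n)) \<le> ereal B"
    proof (rule gap_le[where \<mu> = \<mu> and b = "\<beta> + \<kappa>" and \<epsilon> = \<epsilon>])
      have \<kappa>0: "0 \<le> \<kappa>"
        using s01 binary_entropy_nonneg[of s] by (simp add: \<kappa>_def)
      then show "0 \<le> \<beta> + \<kappa>"
        using \<beta> by simp
      have "\<mu> * ln 2 \<le> exp 1 / (exp 1 - 1) * (h / n) * ln 2"
        using \<mu> by (intro mult_right_mono) auto
      \<comment> \<open>Here \<open>ln 2 = 1 / log 2 (exp 1)\<close>.\<close>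
      also have "\<dots> = exp 1 / ((exp 1 - 1) * log 2 (exp 1)) * (h / real n)"
        by (simp add: log_def field_simps)
      finally have "binary_entropy (min (sqrt (\<mu> * ln 2)) (1 / 2)) \<le> \<beta>"
        unfolding \<beta>_def using M by (intro binary_entropy_mono min.mono) auto
      then have W_le: "shannon_entropy W \<le> ennreal (\<mu> + \<beta>)"
        by (intro order_trans[OF W(2)] ennreal_leI) simp
      have "shannon_entropy ?P = shannon_entropy W + shannon_entropy (coin_pmf s)"
        by (simp add: shannon_entropy_map_inj inj_prod_encode shannon_entropy_pair)
      also have "\<dots> \<le> ennreal (\<mu> + \<beta>) + ennreal \<kappa>"
        using W_le s01 by (intro add_mono) (simp_all add: shannon_entropy_coin_pmf \<kappa>_def)
      also have "\<dots> = ennreal (\<mu> + (\<beta> + \<kappa>))"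
        using M \<beta> \<kappa>0 by (simp add: ennreal_plus[symmetric] add.assoc del: ennreal_plus)
      finally show "shannon_entropy ?P \<le> ennreal (\<mu> + (\<beta> + \<kappa>))" .
      have "\<kappa> \<le> 137 / 100"
        unfolding \<kappa>_def using s by (intro coin_entropy_bound)
      moreover have "\<kappa> \<le> binary_entropy s + (1 - s) * (59 / 36)"
        unfolding \<kappa>_def using s01 log_bounds(1) by (intro add_left_mono mult_left_mono) auto
      ultimately have "\<beta> + \<kappa> + \<epsilon> \<le> 2.43 \<and>
          \<beta> + \<kappa> + \<epsilon> \<le> \<beta> + binary_entropy s + 2 * (1 - s)"
        using \<epsilon>_le \<beta> by (simp add: field_simps)
      then show "\<beta> + \<kappa> + \<epsilon> \<le> B"
        by (simp add: B_def)
    qed (use M \<mu> h r_top assms \<epsilon> in auto)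
    with g show ?thesis
      by (intro exI conjI)
  qed
  then obtain P :: "nat pmf" and g where g: "map_pmf g (Pi_pmf {1..n} 0 (\<lambda>_. P)) = p"
    and gap: "enn2ereal (shannon_entropy P)
      - enn2ereal ?r * (enn2ereal (ennreal h) / ereal (real n)) \<le> ereal B"
    by blast
  obtain \<Omega> :: "(nat \<Rightarrow> nat) pmf" and Z :: "nat \<Rightarrow> (nat \<Rightarrow> nat) \<Rightarrow> nat" and f
    where iid: "prob_space.indep_vars (measure_pmf \<Omega>) (\<lambda>_. count_space UNIV) Z {1..n}"
      "\<forall>i\<in>{1..n}. map_pmf (Z i) \<Omega> = map_pmf (Z 1) \<Omega>"
      "map_pmf (\<lambda>\<omega>. f (\<lambda>i\<in>{1..n}. Z i \<omega>)) \<Omega> = p" "map_pmf (Z 1) \<Omega> = P"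
    using exists_iid_realization[OF assms(2) g] by blast
  have h_real: "enn2real (ennreal h) = h"
    using h by simp
  show ?thesis
    by (intro exI[of _ \<Omega>] exI[of _ Z] exI[of _ f] conjI iid(1-3))
      (use gap in \<open>unfold iid(4) h(1) h_real B_def \<beta>_def s_def\<close>)
qed

end
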